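(* Let $\Gamma$ be a countable set and let $(b_j)_{j\in\Gamma}$ be a family of strictly positive real numbers such that, for every $\varepsilon>0$, the family $$R_j(b_j,\varepsilon)=\int_{\varepsilon b_j}^{+\infty}e^{-x^2/2}\,dx,\qquad j\in\Gamma,$$ is summable. For a subset $E\subseteq\Gamma$, let $B(E)$ be the space of real families $x=(x_j)_{j\in E}$ such that $|x_j|/b_j\to0$ as $j$ goes to infinity in $E$, with norm $\|x\|_{B(E)}=\sup_{j\in E}|x_j|/b_j$. Then, for every $E\subseteq\Gamma$, the space $Z_{\mathbb R}=\ell^2(E,\mathbb{R})$ is densely embedded in $B(E)$. Moreover, for all $t>0$, the restriction to $Z_{\mathbb R}$ of the norm of $B(E)$ is $\mu_{t,Z_{\mathbb R}}$-measurable.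
   Context: "Densely embedded" means that $Z_{\mathbb R}$ is included in $B(E)$ with continuous inclusion and dense range. For a real separable Hilbert space $Z_{\mathbb R}$, a cylinder set is a set $X=\{x\in Z_{\mathbb R}:(\langle f_1,x\rangle,\dots,\langle f_n,x\rangle)\in\Omega\}$ with $n\ge1$, $f_1,\dots,f_n$ orthonormal in $Z_{\mathbb R}$ and $\Omega$ a Borel set of $\mathbb{R}^n$; for $t>0$ its Gaussian cylinder measure is $\mu_{t,Z_{\mathbb R}}(X)=(2\pi t)^{-n/2}\int_\Omega e^{-|x|^2/2t}dx$. A semi-norm $N$ on $Z_{\mathbb R}$ is called $\mu_{t,Z_{\mathbb R}}$-measurable if for every $\varepsilon>0$ there is a finite dimensional subspace $H_\varepsilon$ of $Z_{\mathbb R}$ such that, for every finite dimensional subspace $V$ of $Z_{\mathbb R}$ orthogonal to $H_\varepsilon$, $$\mu_{t,Z_{\mathbb R}}(\{x\in Z_{\mathbb R}:N(P_V(x))>\varepsilon\})<\varepsilon,$$ where $P_V$ is the orthogonal projection onto $V$. *)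

theory Defs
  imports "HOL-Analysis.Analysis"
begin

section \<open>The real Hilbert space of square-summable families\<close>

typedef 'a ell2 = "{x :: 'a \<Rightarrow> real. (\<lambda>j. (x j)\<^sup>2) summable_on UNIV}"
  morphisms ell2_nth Abs_ell2
  by (rule exI[of _ "\<lambda>_. 0"]) simp

setup_lifting type_definition_ell2

lemma square_summable_mult:
  fixes x y :: "'a \<Rightarrow> real"
  assumes "(\<lambda>j. (x j)\<^sup>2) summable_on A" "(\<lambda>j. (y j)\<^sup>2) summable_on A"
  shows "(\<lambda>j. x j * y j) summable_on A"
proof -
  have "(\<lambda>j. (x j)\<^sup>2 + (y j)\<^sup>2) summable_on A"
    using assms by (rule summable_on_add)
  moreover have "\<bar>x j * y j\<bar> \<le> \<bar>(x j)\<^sup>2 + (y j)\<^sup>2\<bar>" for j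
  proof -
    have "0 \<le> (\<bar>x j\<bar> - \<bar>y j\<bar>)\<^sup>2" by simp
    hence "2 * (\<bar>x j\<bar> * \<bar>y j\<bar>) \<le> (x j)\<^sup>2 + (y j)\<^sup>2"
      by (simp add: power2_diff)
    moreover have "0 \<le> \<bar>x j\<bar> * \<bar>y j\<bar>" by simp
    ultimately show ?thesis unfolding abs_mult by linarith
  qed
  ultimately have "(\<lambda>j. norm (x j * y j)) summable_on A"
    by - (rule Infinite_Sum.abs_summable_on_comparison_test[where g = "\<lambda>j. (x j)\<^sup>2 + (y j)\<^sup>2"],
      simp_all only: real_norm_def abs_of_nonneg add_nonneg_nonneg zero_le_power2)
  thus ?thesis by (rule Infinite_Sum.abs_summable_summable)
qed

lemma square_summable_add:
  fixes x y :: "'a \<Rightarrow> real"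
  assumes "(\<lambda>j. (x j)\<^sup>2) summable_on A" "(\<lambda>j. (y j)\<^sup>2) summable_on A"
  shows "(\<lambda>j. (x j + y j)\<^sup>2) summable_on A"
proof -
  have "(\<lambda>j. 2 * (x j * y j)) summable_on A"
    by (rule summable_on_cmult_right) (rule square_summable_mult[OF assms])
  hence "(\<lambda>j. (x j)\<^sup>2 + (y j)\<^sup>2 + 2 * (x j * y j)) summable_on A"
    by (rule summable_on_add[OF summable_on_add[OF assms]])
  thus ?thesis by (simp only: power2_sum mult.assoc)
qed

lemma square_summable_cmult:
  fixes x :: "'a \<Rightarrow> real"
  assumes "(\<lambda>j. (x j)\<^sup>2) summable_on A"
  shows "(\<lambda>j. (c * x j)\<^sup>2) summable_on A"
  unfolding power_mult_distrib by (rule summable_on_cmult_right) (rule assms)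

lemma square_summable_diff:
  fixes x y :: "'a \<Rightarrow> real"
  assumes "(\<lambda>j. (x j)\<^sup>2) summable_on A" "(\<lambda>j. (y j)\<^sup>2) summable_on A"
  shows "(\<lambda>j. (x j - y j)\<^sup>2) summable_on A"
  using square_summable_add[OF assms(1) square_summable_cmult[OF assms(2), of "-1"]] by simp

instantiation ell2 :: (type) real_vector
begin

lift_definition zero_ell2 :: "'a ell2" is "\<lambda>_. 0" by simp

lift_definition plus_ell2 :: "'a ell2 \<Rightarrow> 'a ell2 \<Rightarrow> 'a ell2" is "\<lambda>x y j. x j + y j"
  by (rule square_summable_add)

lift_definition minus_ell2 :: "'a ell2 \<Rightarrow> 'a ell2 \<Rightarrow> 'a ell2" is "\<lambda>x y j. x j - y j"
  by (rule square_summable_diff)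

lift_definition uminus_ell2 :: "'a ell2 \<Rightarrow> 'a ell2" is "\<lambda>x j. - x j" by simp

lift_definition scaleR_ell2 :: "real \<Rightarrow> 'a ell2 \<Rightarrow> 'a ell2" is "\<lambda>c x j. c * x j"
  by (rule square_summable_cmult)

instance
proof
  fix x y z :: "'a ell2" and r s :: real
  show "x + y + z = x + (y + z)" "x + y = y + x" "0 + x = x" "- x + x = 0" "x - y = x + - y"
    by (transfer, simp add: algebra_simps)+
  show "r *\<^sub>R (x + y) = r *\<^sub>R x + r *\<^sub>R y" "(r + s) *\<^sub>R x = r *\<^sub>R x + s *\<^sub>R x"
    "r *\<^sub>R s *\<^sub>R x = (r * s) *\<^sub>R x" "1 *\<^sub>R x = x"
    by (transfer, simp add: algebra_simps)+
qed

end

instantiation ell2 :: (type) real_inner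
begin

lift_definition inner_ell2 :: "'a ell2 \<Rightarrow> 'a ell2 \<Rightarrow> real"
  is "\<lambda>x y. \<Sum>\<^sub>\<infinity>j. x j * y j" .

definition norm_ell2 :: "'a ell2 \<Rightarrow> real" where
  "norm_ell2 x = sqrt (inner x x)"

definition dist_ell2 :: "'a ell2 \<Rightarrow> 'a ell2 \<Rightarrow> real" where
  "dist_ell2 x y = norm (x - y)"

definition sgn_ell2 :: "'a ell2 \<Rightarrow> 'a ell2" where
  "sgn_ell2 x = x /\<^sub>R norm x"

definition uniformity_ell2 :: "('a ell2 \<times> 'a ell2) filter" where
  "uniformity_ell2 = (INF e\<in>{0 <..}. principal {(x, y). dist x y < e})"

definition open_ell2 :: "'a ell2 set \<Rightarrow> bool" where
  "open_ell2 U = (\<forall>x\<in>U. eventually (\<lambda>(x', y). x' = x \<longrightarrow> y \<in> U) uniformity)"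

instance
proof
  fix x y z :: "'a ell2" and r :: real
  show "sgn x = x /\<^sub>R norm x" by (rule sgn_ell2_def)
  show "dist x y = norm (x - y)" by (rule dist_ell2_def)
  show "uniformity = (INF e\<in>{0 <..}. principal {(x :: 'a ell2, y). dist x y < e})"
    by (rule uniformity_ell2_def)
  show "open U = (\<forall>x\<in>U. \<forall>\<^sub>F (x', y) in uniformity. x' = x \<longrightarrow> y \<in> U)" for U :: "'a ell2 set"
    by (rule open_ell2_def)
  show "inner x y = inner y x" by (transfer, simp add: mult.commute)
  show "inner (x + y) z = inner x z + inner y z"
    by (transfer, simp add: distrib_right infsum_add square_summable_mult)
  show "inner (r *\<^sub>R x) y = r * inner x y"
    by (transfer, simp add: mult.assoc infsum_cmult_right')
  show "0 \<le> inner x x" by (transfer, simp add: infsum_nonneg)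
  show "inner x x = 0 \<longleftrightarrow> x = 0"
  proof (transfer, rule iffI)
    fix x :: "'a \<Rightarrow> real"
    assume "(\<lambda>j. (x j)\<^sup>2) summable_on UNIV" "(\<Sum>\<^sub>\<infinity>j. x j * x j) = 0"
    hence "x j * x j = 0" for j
      by (intro nonneg_infsum_le_0D[where f = "\<lambda>j. x j * x j" and A = UNIV])
         (auto simp: power2_eq_square)
    thus "x = (\<lambda>_. 0)" by auto
  qed simp
  show "norm x = sqrt (inner x x)" by (rule norm_ell2_def)
qed

end

text \<open>For an index set \<open>E\<close>, the space \<open>\<ell>\<^sup>2(E, \<real>)\<close> is the (closed) subspace of the families
  that vanish outside \<open>E\<close>, with the inherited inner product, norm and topology.\<close>

definition ell2_on :: "'a set \<Rightarrow> 'a ell2 set" where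
  "ell2_on E = {x. \<forall>j. j \<notin> E \<longrightarrow> ell2_nth x j = 0}"


section \<open>Gaussian cylinder measures and measurable semi-norms\<close>

text \<open>The Hilbert space \<open>Z\<close> is a subspace of an ambient inner product space. Vectors of
  \<open>\<real>\<^sup>n\<close> are functions on \<open>{..<n}\<close>.

  In \<open>cylinder_rep\<close> the dimension \<open>n\<close> is at least 1, except that \<open>n = 0\<close> is allowed for the zero
  space, which contains no orthonormal family with \<open>n \<ge> 1\<close>. There \<open>\<real>\<^sup>0\<close> is a point of mass 1, so
  the cylinder measure is the unit point mass at 0.\<close>

definition cylinder_rep ::
    "'z::real_inner set \<Rightarrow> 'z set \<Rightarrow> nat \<Rightarrow> (nat \<Rightarrow> 'z) \<Rightarrow> (nat \<Rightarrow> real) set \<Rightarrow> bool" where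
  "cylinder_rep Z X n f \<Omega> \<longleftrightarrow>
     (n \<ge> 1 \<or> Z = {0}) \<and>
     (\<forall>i<n. f i \<in> Z) \<and>
     (\<forall>i<n. \<forall>k<n. inner (f i) (f k) = (if i = k then 1 else 0)) \<and>
     \<Omega> \<in> sets (\<Pi>\<^sub>M i\<in>{..<n}. borel) \<and>
     X = {x \<in> Z. (\<lambda>i\<in>{..<n}. inner (f i) x) \<in> \<Omega>}"

definition cylinder_set :: "'z::real_inner set \<Rightarrow> 'z set \<Rightarrow> bool" where
  "cylinder_set Z X \<longleftrightarrow> (\<exists>n f \<Omega>. cylinder_rep Z X n f \<Omega>)"

text \<open>The value does not depend on the chosen representation, because the standard Gaussian
  measure is rotation invariant. It is meaningful only if \<open>X\<close> is a cylinder set.\<close>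

definition gaussian_cylinder_measure :: "real \<Rightarrow> 'z::real_inner set \<Rightarrow> 'z set \<Rightarrow> real" where
  "gaussian_cylinder_measure t Z X =
     (SOME m. \<exists>n f \<Omega>. cylinder_rep Z X n f \<Omega> \<and>
        m = (2 * pi * t) powr (- (real n / 2)) *
            (LINT y:\<Omega>|(\<Pi>\<^sub>M i\<in>{..<n}. lborel). exp (- (\<Sum>i<n. (y i)\<^sup>2) / (2 * t))))"

definition seminorm_on :: "'z::real_vector set \<Rightarrow> ('z \<Rightarrow> real) \<Rightarrow> bool" where
  "seminorm_on Z N \<longleftrightarrow>
     (\<forall>x\<in>Z. 0 \<le> N x) \<and>
     (\<forall>x\<in>Z. \<forall>c. N (c *\<^sub>R x) = \<bar>c\<bar> * N x) \<and>
     (\<forall>x\<in>Z. \<forall>y\<in>Z. N (x + y) \<le> N x + N y)"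

definition finite_dim_subspace :: "'z::real_vector set \<Rightarrow> 'z set \<Rightarrow> bool" where
  "finite_dim_subspace Z V \<longleftrightarrow> V \<subseteq> Z \<and> (\<exists>B. finite B \<and> V = span B)"

definition orth_proj :: "'z::real_inner set \<Rightarrow> 'z \<Rightarrow> 'z" where
  "orth_proj V x = (THE v. v \<in> V \<and> (\<forall>w\<in>V. orthogonal (x - v) w))"

text \<open>That the set \<open>{x \<in> Z. N (orth_proj V x) > \<epsilon>}\<close> is a cylinder set is part of the definition,
  so that its cylinder measure makes sense.\<close>

definition measurable_seminorm :: "real \<Rightarrow> 'z::real_inner set \<Rightarrow> ('z \<Rightarrow> real) \<Rightarrow> bool" where
  "measurable_seminorm t Z N \<longleftrightarrow>
     seminorm_on Z N \<and>
     (\<forall>\<epsilon>>0. \<exists>H. finite_dim_subspace Z H \<and>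
        (\<forall>V. finite_dim_subspace Z V \<and> (\<forall>v\<in>V. \<forall>h\<in>H. orthogonal v h) \<longrightarrow>
           cylinder_set Z {x \<in> Z. N (orth_proj V x) > \<epsilon>} \<and>
           gaussian_cylinder_measure t Z {x \<in> Z. N (orth_proj V x) > \<epsilon>} < \<epsilon>))"


section \<open>The spaces \<open>B(E)\<close>\<close>

text \<open>Families indexed by \<open>E\<close> are functions vanishing outside \<open>E\<close>; ``\<open>j\<close> goes to infinity in
  \<open>E\<close>'' is the filter of cofinite subsets of \<open>E\<close>.\<close>

definition B_space :: "('a \<Rightarrow> real) \<Rightarrow> 'a set \<Rightarrow> ('a \<Rightarrow> real) set" where
  "B_space b E = {x. (\<forall>j. j \<notin> E \<longrightarrow> x j = 0) \<and>
     ((\<lambda>j. \<bar>x j\<bar> / b j) \<longlongrightarrow> 0) (inf cofinite (principal E))}"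

definition B_norm :: "('a \<Rightarrow> real) \<Rightarrow> 'a set \<Rightarrow> ('a \<Rightarrow> real) \<Rightarrow> real" where
  "B_norm b E x = (if E = {} then 0 else (SUP j\<in>E. \<bar>x j\<bar> / b j))"

text \<open>The value 0 off \<open>B_space b E\<close> is arbitrary: the locale \<^locale>\<open>Metric_space\<close> requires
  distances to be nonnegative also off the carrier.\<close>

definition B_dist :: "('a \<Rightarrow> real) \<Rightarrow> 'a set \<Rightarrow> ('a \<Rightarrow> real) \<Rightarrow> ('a \<Rightarrow> real) \<Rightarrow> real" where
  "B_dist b E x y =
     (if x \<in> B_space b E \<and> y \<in> B_space b E then B_norm b E (\<lambda>j. x j - y j) else 0)"

definition B_topology :: "('a \<Rightarrow> real) \<Rightarrow> 'a set \<Rightarrow> ('a \<Rightarrow> real) topology" where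
  "B_topology b E = Metric_space.mtopology (B_space b E) (B_dist b E)"

lemma B_space_diff:
  assumes "\<And>j. j \<in> E \<Longrightarrow> 0 < b j" "x \<in> B_space b E" "y \<in> B_space b E"
  shows "(\<lambda>j. x j - y j) \<in> B_space b E"
proof -
  let ?F = "inf cofinite (principal E)"
  have "((\<lambda>j. \<bar>x j\<bar> / b j + \<bar>y j\<bar> / b j) \<longlongrightarrow> 0 + 0) ?F"
    using assms unfolding B_space_def by (intro tendsto_add) auto
  moreover have "\<forall>\<^sub>F j in ?F. norm (\<bar>x j - y j\<bar> / b j) \<le> \<bar>x j\<bar> / b j + \<bar>y j\<bar> / b j"
    unfolding eventually_inf_principal
  proof (intro always_eventually allI impI)
    fix j assume "j \<in> E"
    hence "0 < b j" by (rule assms(1))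
    hence "\<bar>x j - y j\<bar> / b j \<le> (\<bar>x j\<bar> + \<bar>y j\<bar>) / b j"
      by (intro divide_right_mono) auto
    with \<open>0 < b j\<close> show "norm (\<bar>x j - y j\<bar> / b j) \<le> \<bar>x j\<bar> / b j + \<bar>y j\<bar> / b j"
      by (simp add: add_divide_distrib)
  qed
  ultimately have "((\<lambda>j. \<bar>x j - y j\<bar> / b j) \<longlongrightarrow> 0) ?F"
    by - (rule Lim_null_comparison, assumption, simp)
  thus ?thesis using assms unfolding B_space_def by auto
qed

lemma B_space_bdd_above:
  assumes "x \<in> B_space b E"
  shows "bdd_above ((\<lambda>j. \<bar>x j\<bar> / b j) ` E)"
proof -
  have "\<forall>\<^sub>F j in inf cofinite (principal E). \<bar>x j\<bar> / b j < 1"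
    using assms unfolding B_space_def by (auto intro: order_tendstoD)
  hence "finite {j. \<not> (j \<in> E \<longrightarrow> \<bar>x j\<bar> / b j < 1)}"
    by (simp add: eventually_inf_principal eventually_cofinite)
  hence "bdd_above ((\<lambda>j. \<bar>x j\<bar> / b j) ` {j. \<not> (j \<in> E \<longrightarrow> \<bar>x j\<bar> / b j < 1)})"
    by (intro bdd_above_finite finite_imageI)
  moreover have "bdd_above {..<1::real}" by simp
  ultimately have "bdd_above ({..<1} \<union>
      (\<lambda>j. \<bar>x j\<bar> / b j) ` {j. \<not> (j \<in> E \<longrightarrow> \<bar>x j\<bar> / b j < 1)})"
    by simp
  thus ?thesis by (rule bdd_above_mono) auto
qed

lemma B_norm_upper:
  assumes "x \<in> B_space b E" "j \<in> E"
  shows "\<bar>x j\<bar> / b j \<le> B_norm b E x"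
  using assms B_space_bdd_above[OF assms(1)] by (auto simp: B_norm_def intro: cSUP_upper)

lemma B_norm_nonneg:
  assumes "\<And>j. j \<in> E \<Longrightarrow> 0 < b j" "x \<in> B_space b E"
  shows "0 \<le> B_norm b E x"
proof (cases "E = {}")
  case False
  then obtain j where "j \<in> E" by blast
  with B_norm_upper[OF assms(2) this] assms(1)[OF this] show ?thesis
    by (meson abs_ge_zero divide_nonneg_pos order_trans)
qed (simp add: B_norm_def)

lemma Metric_space_B:
  assumes b: "\<And>j. j \<in> E \<Longrightarrow> 0 < b j"
  shows "Metric_space (B_space b E) (B_dist b E)"
proof
  fix x y z
  show "0 \<le> B_dist b E x y"
    unfolding B_dist_def by (auto intro!: B_norm_nonneg B_space_diff b)
  show "B_dist b E x y = B_dist b E y x"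
    unfolding B_dist_def B_norm_def by (simp add: abs_minus_commute conj_commute)
  assume x: "x \<in> B_space b E" and y: "y \<in> B_space b E"
  have up: "\<bar>u j - v j\<bar> / b j \<le> B_dist b E u v"
    if "u \<in> B_space b E" "v \<in> B_space b E" "j \<in> E" for u v j
    using B_norm_upper[OF B_space_diff[OF b that(1,2)] that(3)] that by (simp add: B_dist_def)
  show "B_dist b E x y = 0 \<longleftrightarrow> x = y"
  proof
    assume d: "B_dist b E x y = 0"
    show "x = y"
    proof
      fix j
      show "x j = y j"
      proof (cases "j \<in> E")
        case True
        from up[OF x y True] d b[OF True] show ?thesis by (simp add: divide_le_0_iff)
      next
        case False
        with x y show ?thesis by (simp add: B_space_def)
      qed
    qed
  qed (auto simp: B_dist_def B_norm_def)
  assume z: "z \<in> B_space b E"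
  show "B_dist b E x z \<le> B_dist b E x y + B_dist b E y z"
  proof (cases "E = {}")
    case False
    have "\<bar>x j - z j\<bar> / b j \<le> B_dist b E x y + B_dist b E y z" if j: "j \<in> E" for j
    proof -
      have "\<bar>x j - z j\<bar> / b j \<le> (\<bar>x j - y j\<bar> + \<bar>y j - z j\<bar>) / b j"
        using b[OF j] by (intro divide_right_mono) auto
      also have "\<dots> \<le> B_dist b E x y + B_dist b E y z"
        unfolding add_divide_distrib by (intro add_mono up x y z j)
      finally show ?thesis .
    qed
    hence "(SUP j\<in>E. \<bar>x j - z j\<bar> / b j) \<le> B_dist b E x y + B_dist b E y z"
      using False by (intro cSUP_least) auto
    thus ?thesis using x z False by (simp add: B_dist_def B_norm_def)
  qed (simp add: B_dist_def B_norm_def)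
qed

text \<open>The inclusion of \<open>\<ell>\<^sup>2(E, \<real>)\<close> into \<open>B(E)\<close> is \<^const>\<open>ell2_nth\<close>, which maps an element to its
  family of coordinates.\<close>

definition densely_embedded :: "('a \<Rightarrow> real) \<Rightarrow> 'a set \<Rightarrow> bool" where
  "densely_embedded b E \<longleftrightarrow>
     ell2_nth ` ell2_on E \<subseteq> B_space b E \<and>
     continuous_map (top_of_set (ell2_on E)) (B_topology b E) ell2_nth \<and>
     (B_topology b E) closure_of (ell2_nth ` ell2_on E) = B_space b E"

definition gaussian_tail :: "real \<Rightarrow> real \<Rightarrow> real" where
  "gaussian_tail \<beta> \<epsilon> = (LINT x:{\<epsilon> * \<beta>..}|lborel. exp (- x\<^sup>2 / 2))"

end

theory Submission
  imports Defs "HOL-Probability.Distributions"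
begin

text \<open>Summability of the tails has two effects.

  First, the weights tend to infinity (\<open>finite_weights_le\<close>), so on each \<open>E\<close> they are bounded below by
  some \<open>m > 0\<close>. The inclusion of \<open>\<ell>\<^sup>2(E)\<close> into \<open>B(E)\<close> then has norm at most \<open>1 / m\<close>, and
  the families of finite support are dense in \<open>B(E)\<close> (\<open>densely_embedded_if_bounded_below\<close>).

  Second, the norm is measurable. Let \<open>F \<subseteq> E\<close> be finite and let \<open>V\<close> be a finite-dimensional subspace
  orthogonal to the unit vectors \<open>e\<^sub>j\<close> with \<open>j \<in> F\<close>. The \<open>j\<close>-th coordinate of \<open>P\<^sub>V x\<close> is
  the inner product of \<open>x\<close> with \<open>P\<^sub>V e\<^sub>j\<close>, a vector of norm at most 1 that is 0 for \<open>j \<in> F\<close>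
  (\<open>coordinate_of_orth_proj\<close>). Under the Gaussian cylinder measure it is a centred normal variable of
  variance at most \<open>t\<close>, so it exceeds \<open>\<epsilon> b\<^sub>j\<close> in absolute value with probability at most
  \<open>gaussian_tail (b j) (\<epsilon> / sqrt t)\<close> (\<open>gaussian_linear_functional_tail\<close>). The union bound over
  \<open>E - F\<close> (\<open>gaussian_cylinder_measure_B_norm_le\<close>) gives the tail of a convergent series, which is
  below \<open>\<epsilon>\<close> if \<open>F\<close> is large; so the span of the \<open>e\<^sub>j\<close> with \<open>j \<in> F\<close> serves as \<open>H\<^sub>\<epsilon>\<close>.

  The cylinder measure is defined through some representation of the cylinder set, with an
  unknown orthonormal family. In each representation the measure is the law of a Gaussian vector
  in the span of that family (\<open>gaussian_cylinder_measure_eq\<close>), and by Bessel's inequality the bound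
  on the variance holds whichever family it is.\<close>

section \<open>Gaussian product measures\<close>

abbreviation gaussian_product :: "real \<Rightarrow> nat \<Rightarrow> (nat \<Rightarrow> real) measure" where
  "gaussian_product t n \<equiv> (\<Pi>\<^sub>M i\<in>{..<n}. density lborel (normal_density 0 (sqrt t)))"

lemma prob_space_gaussian_product:
  assumes "0 < t"
  shows "prob_space (gaussian_product t n)"
  using assms by (intro prob_space_PiM prob_space_normal_density) simp

text \<open>Both sides agree on boxes by Fubini, and boxes determine a \<open>\<sigma>\<close>-finite product measure.\<close>

lemma PiM_density_prod:
  fixes f :: "'i \<Rightarrow> 'a \<Rightarrow> ennreal"
  assumes I: "finite I"
    and M: "product_sigma_finite M"
    and f[measurable]: "\<And>i. f i \<in> borel_measurable (M i)"
    and D: "product_sigma_finite (\<lambda>i. density (M i) (f i))"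
  shows "(\<Pi>\<^sub>M i\<in>I. density (M i) (f i)) = density (Pi\<^sub>M I M) (\<lambda>y. \<Prod>i\<in>I. f i (y i))"
proof (rule product_sigma_finite.PiM_eqI[OF D I, symmetric])
  interpret product_sigma_finite M by (rule M)
  show "sets (density (Pi\<^sub>M I M) (\<lambda>y. \<Prod>i\<in>I. f i (y i))) = sets (\<Pi>\<^sub>M i\<in>I. density (M i) (f i))"
    by (simp cong: sets_PiM_cong)
  fix A assume "\<And>i. i \<in> I \<Longrightarrow> A i \<in> sets (density (M i) (f i))"
  hence A[measurable]: "\<And>i. i \<in> I \<Longrightarrow> A i \<in> sets (M i)" by simp
  have "emeasure (density (Pi\<^sub>M I M) (\<lambda>y. \<Prod>i\<in>I. f i (y i))) (Pi\<^sub>E I A) =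
      (\<integral>\<^sup>+y. (\<Prod>i\<in>I. f i (y i)) * indicator (Pi\<^sub>E I A) y \<partial>Pi\<^sub>M I M)"
    using I A by (subst emeasure_density) (auto intro!: sets_PiM_I_finite)
  also have "\<dots> = (\<integral>\<^sup>+y. (\<Prod>i\<in>I. f i (y i) * indicator (A i) (y i)) \<partial>Pi\<^sub>M I M)"
  proof (rule nn_integral_cong)
    fix y assume y: "y \<in> space (Pi\<^sub>M I M)"
    show "(\<Prod>i\<in>I. f i (y i)) * indicator (Pi\<^sub>E I A) y = (\<Prod>i\<in>I. f i (y i) * indicator (A i) (y i))"
    proof (cases "y \<in> Pi\<^sub>E I A")
      case True
      thus ?thesis by (auto intro!: prod.cong simp: PiE_iff)
    next
      case False
      with y obtain i where "i \<in> I" "y i \<notin> A i" by (auto simp: space_PiM PiE_iff)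
      hence "f i (y i) * indicator (A i) (y i) = 0" by simp
      with I \<open>i \<in> I\<close> have "(\<Prod>i\<in>I. f i (y i) * indicator (A i) (y i)) = 0"
        by (intro prod_zero) blast+
      with False show ?thesis by simp
    qed
  qed
  also have "\<dots> = (\<Prod>i\<in>I. \<integral>\<^sup>+x. f i x * indicator (A i) x \<partial>M i)"
    using A I by (intro product_nn_integral_prod) auto
  also have "\<dots> = (\<Prod>i\<in>I. emeasure (density (M i) (f i)) (A i))"
    using A by (auto intro!: prod.cong simp: emeasure_density)
  finally show "emeasure (density (Pi\<^sub>M I M) (\<lambda>y. \<Prod>i\<in>I. f i (y i))) (Pi\<^sub>E I A) =
      (\<Prod>i\<in>I. emeasure (density (M i) (f i)) (A i))" .
qed

lemma measure_density_eq_set_lebesgue_integral: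
  fixes f :: "'a \<Rightarrow> real"
  assumes [measurable]: "f \<in> borel_measurable M" "A \<in> sets M" and f: "\<And>x. 0 \<le> f x"
  shows "measure (density M f) A = (LINT x:A|M. f x)"
proof -
  have "A \<inter> space M = A" using sets.sets_into_space[OF assms(2)] by blast
  hence "measure (density M f) A = (LINT x|density M f. indicator A x)"
    by simp
  also have "\<dots> = (LINT x|M. f x *\<^sub>R indicator A x)"
    using f by (intro integral_density) auto
  also have "\<dots> = (LINT x:A|M. f x)"
    by (simp add: set_lebesgue_integral_def mult.commute)
  finally show ?thesis .
qed

text \<open>The normalizing factor \<open>(2 \<pi> t)\<^sup>-\<^sup>n\<^sup>/\<^sup>2\<close> splits into \<open>n\<close> factors, one for each coordinate,
  so the density of the Gaussian cylinder measure is a product of one-dimensional normal densities.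
  This lets probability theory speak about cylinder measures.\<close>

lemma gaussian_integral_eq_measure:
  assumes t: "0 < t" and \<Omega>: "\<Omega> \<in> sets (\<Pi>\<^sub>M i\<in>{..<n}. borel)"
  shows "(2 * pi * t) powr (- (real n / 2)) *
      (LINT y:\<Omega>|(\<Pi>\<^sub>M i\<in>{..<n}. lborel). exp (- (\<Sum>i<n. (y i)\<^sup>2) / (2 * t))) =
    measure (gaussian_product t n) \<Omega>"
proof -
  let ?L = "\<Pi>\<^sub>M i\<in>{..<n}. (lborel :: real measure)"
  let ?g = "normal_density 0 (sqrt t)"
  have L: "product_sigma_finite (\<lambda>i::nat. lborel :: real measure)"
    by (simp add: product_sigma_finite_def sigma_finite_lborel)
  have D: "product_sigma_finite (\<lambda>i::nat. density lborel ?g)"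
    using t by (auto simp: product_sigma_finite_def
      intro!: prob_space_imp_sigma_finite prob_space_normal_density)
  have sL: "sets ?L = sets (\<Pi>\<^sub>M i\<in>{..<n}. borel)"
    by (rule sets_PiM_cong) auto
  have \<Omega>'[measurable]: "\<Omega> \<in> sets ?L" using \<Omega> sL by simp
  have pr: "(\<Prod>i<n. ?g (y i)) = (2 * pi * t) powr (- (real n / 2)) * exp (- (\<Sum>i<n. (y i)\<^sup>2) / (2 * t))"
    for y :: "nat \<Rightarrow> real"
  proof -
    have "1 / sqrt (2 * pi * t) = (2 * pi * t) powr (- (1/2))"
      using t by (simp add: powr_minus powr_half_sqrt divide_simps)
    hence "(1 / sqrt (2 * pi * t)) ^ n = (2 * pi * t) powr (- (real n / 2))"
      using t by (simp add: powr_realpow[symmetric] powr_powr)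
    moreover have "(\<Prod>i<n. exp (- (y i)\<^sup>2 / (2 * t))) = exp (- (\<Sum>i<n. (y i)\<^sup>2) / (2 * t))"
      by (simp add: exp_sum[symmetric] sum_negf sum_divide_distrib)
    ultimately show ?thesis using t
      by (simp only: normal_density_def prod.distrib prod_constant card_lessThan) simp
  qed
  have "gaussian_product t n = density ?L (\<lambda>y. \<Prod>i<n. ennreal (?g (y i)))"
    using L D by (intro PiM_density_prod) auto
  also have "\<dots> = density ?L (\<lambda>y. ennreal (\<Prod>i<n. ?g (y i)))"
    by (simp add: prod_ennreal)
  finally have "measure (gaussian_product t n) \<Omega> = (LINT y:\<Omega>|?L. (\<Prod>i<n. ?g (y i)))"
    by (simp add: measure_density_eq_set_lebesgue_integral prod_nonneg)
  also have "\<dots> = (2 * pi * t) powr (- (real n / 2)) *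
      (LINT y:\<Omega>|?L. exp (- (\<Sum>i<n. (y i)\<^sup>2) / (2 * t)))"
    by (simp only: pr set_integral_mult_right)
  finally show ?thesis by simp
qed

lemma gaussian_tail_eq_measure:
  "sqrt (2 * pi) * measure (density lborel std_normal_density) {\<epsilon> * \<beta>..} = gaussian_tail \<beta> \<epsilon>"
proof -
  have "measure (density lborel std_normal_density) {\<epsilon> * \<beta>..} =
      (LINT x:{\<epsilon> * \<beta>..}|lborel. std_normal_density x)"
    by (rule measure_density_eq_set_lebesgue_integral) auto
  also have "\<dots> = (LINT x:{\<epsilon> * \<beta>..}|lborel. (1 / sqrt (2 * pi)) * exp (- x\<^sup>2 / 2))"
    by (simp only: std_normal_density_def)
  also have "\<dots> = (1 / sqrt (2 * pi)) * gaussian_tail \<beta> \<epsilon>"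
    by (simp only: gaussian_tail_def set_integral_mult_right)
  finally show ?thesis by simp
qed

lemma gaussian_tail_nonneg: "0 \<le> gaussian_tail \<beta> \<epsilon>"
  by (simp add: gaussian_tail_eq_measure[symmetric])

lemma measurable_gaussian_coordinate:
  "i < n \<Longrightarrow> (\<lambda>y. y i) \<in> borel_measurable (gaussian_product t n)"
  using measurable_component_singleton[of i "{..<n}"
    "\<lambda>_. density lborel (normal_density 0 (sqrt t))"] by simp

lemma indep_vars_gaussian_coordinates:
  assumes t: "0 < t"
  shows "prob_space.indep_vars (gaussian_product t n) (\<lambda>_. borel) (\<lambda>i y. y i) {..<n}"
proof (cases "n = 0")
  case True
  interpret prob_space "gaussian_product t n" by (rule prob_space_gaussian_product[OF t])
  show ?thesis unfolding indep_vars_def indep_sets_def using True by simp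
next
  case False
  interpret prob_space "gaussian_product t n" by (rule prob_space_gaussian_product[OF t])
  let ?g = "density lborel (normal_density 0 (sqrt t))"
  have c: "distr (gaussian_product t n) borel (\<lambda>y. y i) = ?g" if "i < n" for i
  proof -
    have "distr (gaussian_product t n) ?g (\<lambda>y. y i) = ?g"
      using t that by (intro distr_PiM_component prob_space_normal_density) auto
    thus ?thesis by (simp cong: distr_cong)
  qed
  have [measurable_cong]: "sets (gaussian_product t n) = sets (\<Pi>\<^sub>M i\<in>{..<n}. borel)"
    by (rule sets_PiM_cong) auto
  have "distr (gaussian_product t n) (\<Pi>\<^sub>M i\<in>{..<n}. borel) (\<lambda>x. \<lambda>i\<in>{..<n}. x i) =
      distr (gaussian_product t n) (gaussian_product t n) (\<lambda>x. x)"
    by (intro distr_cong) (auto simp: space_PiM PiE_iff extensional_restrict intro!: sets_PiM_cong)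
  also have "\<dots> = (\<Pi>\<^sub>M i\<in>{..<n}. distr (gaussian_product t n) borel (\<lambda>y. y i))"
    unfolding distr_id by (intro PiM_cong) (auto simp: c)
  finally show ?thesis
    using False by (subst indep_vars_iff_distr_eq_PiM') (auto intro: measurable_gaussian_coordinate)
qed

section \<open>Tails of linear functionals of a Gaussian vector\<close>

text \<open>A sum of independent centred normal variables is normal. Coordinates with coefficient 0 are left
  out first, because a normal density with variance 0 is degenerate.\<close>

lemma distributed_gaussian_linear_functional:
  assumes t: "0 < t" and a: "0 < (\<Sum>i<n. (a i)\<^sup>2)"
  shows "distributed (gaussian_product t n) lborel (\<lambda>y. \<Sum>i<n. a i * y i)
    (normal_density 0 (sqrt (t * (\<Sum>i<n. (a i)\<^sup>2))))"
proof -
  interpret prob_space "gaussian_product t n" by (rule prob_space_gaussian_product[OF t])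
  define I where "I = {i. i < n \<and> a i \<noteq> 0}"
  have I: "finite I" "I \<subseteq> {..<n}" by (auto simp: I_def)
  have ne: "I \<noteq> {}"
  proof
    assume "I = {}"
    hence "(\<Sum>i<n. (a i)\<^sup>2) = 0" by (intro sum.neutral) (auto simp: I_def)
    with a show False by simp
  qed
  have coord: "distributed (gaussian_product t n) lborel (\<lambda>y. y i) (normal_density 0 (sqrt t))"
    if "i < n" for i
  proof -
    have "distr (gaussian_product t n) (density lborel (normal_density 0 (sqrt t))) (\<lambda>y. y i) =
        density lborel (normal_density 0 (sqrt t))"
      using t that by (intro distr_PiM_component prob_space_normal_density) auto
    hence "distr (gaussian_product t n) lborel (\<lambda>y. y i) = density lborel (normal_density 0 (sqrt t))"
      by (simp cong: distr_cong)
    moreover have "(\<lambda>y. y i) \<in> measurable (gaussian_product t n) lborel"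
      using measurable_gaussian_coordinate[OF that] by simp
    ultimately show ?thesis by (simp add: distributed_def)
  qed
  have "distributed (gaussian_product t n) lborel (\<lambda>y. \<Sum>i\<in>I. a i * y i)
      (normal_density (\<Sum>i\<in>I. 0) (sqrt (\<Sum>i\<in>I. (\<bar>a i\<bar> * sqrt t)\<^sup>2)))"
  proof (rule sum_indep_normal[OF I(1) ne])
    show "indep_vars (\<lambda>_. borel) (\<lambda>i y. a i * y i) I"
      by (rule indep_vars_compose2[OF indep_vars_subset[OF indep_vars_gaussian_coordinates[OF t] I(2)]])
        simp
    show "0 < \<bar>a i\<bar> * sqrt t" if "i \<in> I" for i
      using that t by (simp add: I_def)
    show "distributed (gaussian_product t n) lborel (\<lambda>y. a i * y i) (normal_density 0 (\<bar>a i\<bar> * sqrt t))"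
      if "i \<in> I" for i
      using normal_density_affine[OF coord, of i "a i" 0] that t by (simp add: I_def)
  qed
  moreover have "(\<Sum>i\<in>I. a i * y i) = (\<Sum>i<n. a i * y i)" for y
    by (rule sum.mono_neutral_left) (auto simp: I_def)
  moreover have "(\<Sum>i\<in>I. (\<bar>a i\<bar> * sqrt t)\<^sup>2) = t * (\<Sum>i<n. (a i)\<^sup>2)"
  proof -
    have "(\<Sum>i\<in>I. (\<bar>a i\<bar> * sqrt t)\<^sup>2) = (\<Sum>i\<in>I. t * (a i)\<^sup>2)"
      using t by (simp add: power_mult_distrib mult.commute)
    also have "\<dots> = (\<Sum>i<n. t * (a i)\<^sup>2)"
      by (rule sum.mono_neutral_left) (auto simp: I_def)
    finally show ?thesis by (simp add: sum_distrib_left)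
  qed
  ultimately show ?thesis by simp
qed

text \<open>A linear functional with coefficients of norm at most 1 has variance at most \<open>t\<close>; rescaling it to
  variance 1 moves the threshold \<open>c\<close> to at least \<open>c / \<surd>t\<close>.\<close>

lemma gaussian_linear_functional_upper_tail:
  assumes t: "0 < t" and a: "(\<Sum>i<n. (a i)\<^sup>2) \<le> 1" and c: "0 < c"
  shows "measure (gaussian_product t n) {y \<in> space (gaussian_product t n). c < (\<Sum>i<n. a i * y i)} \<le>
    gaussian_tail c (1 / sqrt t) / sqrt (2 * pi)"
proof (cases "(\<Sum>i<n. (a i)\<^sup>2) = 0")
  case True
  hence "a i = 0" if "i < n" for i
    using that by (subst (asm) sum_nonneg_eq_0_iff) auto
  hence empty: "{y \<in> space (gaussian_product t n). c < (\<Sum>i<n. a i * y i)} = {}"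
    using c by auto
  show ?thesis unfolding empty
    by (simp add: gaussian_tail_nonneg)
next
  case False
  define s where "s = (\<Sum>i<n. (a i)\<^sup>2)"
  have s: "0 < s" "s \<le> 1"
    using False a by (auto simp: s_def order_less_le sum_nonneg)
  let ?P = "gaussian_product t n" and ?S = "\<lambda>y. \<Sum>i<n. a i * y i"
  interpret prob_space ?P by (rule prob_space_gaussian_product[OF t])
  have "distributed ?P lborel ?S (normal_density 0 (sqrt (t * s)))"
    using distributed_gaussian_linear_functional[OF t] s by (simp add: s_def)
  hence D: "distributed ?P lborel (\<lambda>y. ?S y / sqrt (t * s)) std_normal_density"
    using t s by (subst (asm) normal_standard_normal_convert) auto
  have m: "(\<lambda>y. ?S y / sqrt (t * s)) \<in> measurable ?P lborel"
    by (rule distributed_measurable[OF D])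
  have le: "c / sqrt t \<le> ?S y / sqrt (t * s)" if "c < ?S y" for y
  proof -
    have "c / sqrt t \<le> c / sqrt (t * s)"
      using t s c by (intro divide_left_mono) (auto simp: mult_le_cancel_left2)
    also have "\<dots> \<le> ?S y / sqrt (t * s)"
      using that t s by (intro divide_right_mono) auto
    finally show ?thesis .
  qed
  have "measure ?P {y \<in> space ?P. c < ?S y} \<le>
      measure ?P ((\<lambda>y. ?S y / sqrt (t * s)) -` {c / sqrt t..} \<inter> space ?P)"
    using le by (intro finite_measure_mono measurable_sets[OF m]) auto
  also have "\<dots> = measure (distr ?P lborel (\<lambda>y. ?S y / sqrt (t * s))) {c / sqrt t..}"
    using m by (simp add: measure_distr)
  also have "\<dots> = measure (density lborel std_normal_density) {1 / sqrt t * c..}"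
    by (simp add: distributed_distr_eq_density[OF D])
  also have "\<dots> = gaussian_tail c (1 / sqrt t) / sqrt (2 * pi)"
    by (simp add: gaussian_tail_eq_measure[symmetric])
  finally show ?thesis .
qed

text \<open>The two one-sided tails contribute the factor \<open>2 / \<surd>(2 \<pi>)\<close>, which is below 1.\<close>

lemma gaussian_linear_functional_tail:
  assumes t: "0 < t" and a: "(\<Sum>i<n. (a i)\<^sup>2) \<le> 1" and c: "0 < c"
  shows "measure (gaussian_product t n) {y \<in> space (gaussian_product t n). c < \<bar>\<Sum>i<n. a i * y i\<bar>} \<le>
    gaussian_tail c (1 / sqrt t)"
proof -
  let ?P = "gaussian_product t n"
  let ?T = "gaussian_tail c (1 / sqrt t)"
  let ?A = "\<lambda>a. {y \<in> space ?P. c < (\<Sum>i<n. a i * y i)}"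
  have [measurable]: "(\<lambda>y. y i) \<in> borel_measurable ?P" if "i < n" for i
    by (rule measurable_gaussian_coordinate[OF that])
  have "{y \<in> space ?P. c < \<bar>\<Sum>i<n. a i * y i\<bar>} = ?A a \<union> ?A (\<lambda>i. - a i)"
    using c by (auto simp: sum_negf abs_real_def)
  moreover have "measure ?P (?A a \<union> ?A (\<lambda>i. - a i)) \<le> measure ?P (?A a) + measure ?P (?A (\<lambda>i. - a i))"
    by (intro measure_Un_le) measurable
  moreover have "measure ?P (?A a) \<le> ?T / sqrt (2 * pi)"
    by (rule gaussian_linear_functional_upper_tail[OF t a c])
  moreover have "measure ?P (?A (\<lambda>i. - a i)) \<le> ?T / sqrt (2 * pi)"
    using a by (intro gaussian_linear_functional_upper_tail[OF t _ c]) simp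
  moreover have "2 * (?T / sqrt (2 * pi)) \<le> ?T"
  proof -
    have "sqrt (2\<^sup>2) \<le> sqrt (2 * pi)" using pi_gt3 by (intro real_sqrt_le_mono) simp
    hence "2 \<le> sqrt (2 * pi)" by simp
    moreover have "0 \<le> ?T" by (rule gaussian_tail_nonneg)
    ultimately have "2 * ?T \<le> sqrt (2 * pi) * ?T" by (rule mult_right_mono)
    thus ?thesis by (simp add: divide_simps mult.commute)
  qed
  ultimately show ?thesis by simp
qed

section \<open>Summability and weights\<close>

lemma (in finite_measure) measure_countable_Union_le_infsum:
  assumes E: "countable E" and g: "g summable_on E"
    and A[measurable]: "\<And>j. j \<in> E \<Longrightarrow> A j \<in> sets M" and le: "\<And>j. j \<in> E \<Longrightarrow> measure M (A j) \<le> g j"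
  shows "measure M (\<Union>j\<in>E. A j) \<le> infsum g E"
proof (cases "finite E")
  case True
  have "measure M (\<Union>j\<in>E. A j) \<le> (\<Sum>j\<in>E. measure M (A j))"
    using True A by (intro finite_measure_subadditive_finite) auto
  also have "\<dots> \<le> (\<Sum>j\<in>E. g j)" using le by (rule sum_mono)
  finally show ?thesis using True by simp
next
  case False
  let ?h = "from_nat_into E"
  have h: "bij_betw ?h UNIV E" by (rule bij_betw_from_nat_into[OF E False])
  hence hE: "?h k \<in> E" for k by (auto simp: bij_betw_def)
  have "((\<lambda>k. g (?h k)) has_sum infsum g E) UNIV"
    using g by (subst has_sum_reindex_bij_betw[OF h]) (rule has_sum_infsum)
  hence s: "(\<lambda>k. g (?h k)) sums infsum g E" by (rule has_sum_imp_sums)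
  have s': "summable (\<lambda>k. measure M (A (?h k)))"
    by (rule summable_comparison_test'[OF sums_summable[OF s], of 0]) (simp add: le hE)
  have "(\<Union>j\<in>E. A j) = (\<Union>j\<in>range ?h. A j)"
    by (simp only: bij_betw_imp_surj_on[OF h])
  also have "\<dots> = (\<Union>k. A (?h k))" by (simp only: image_image)
  finally have "measure M (\<Union>j\<in>E. A j) = measure M (\<Union>k. A (?h k))" by (rule arg_cong)
  also have "\<dots> \<le> (\<Sum>k. measure M (A (?h k)))"
    using hE A s' by (intro finite_measure_subadditive_countably) auto
  also have "\<dots> \<le> (\<Sum>k. g (?h k))"
    using le hE s' sums_summable[OF s] by (intro suminf_le) auto
  finally show ?thesis using sums_unique[OF s] by simp
qed

lemma finite_superlevel_set_of_summable:
  fixes f :: "'a \<Rightarrow> real"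
  assumes f: "f summable_on A" and nonneg: "\<And>j. j \<in> A \<Longrightarrow> 0 \<le> f j" and \<delta>: "0 < \<delta>"
  shows "finite {j \<in> A. \<delta> \<le> f j}"
proof (rule ccontr)
  assume inf: "infinite {j \<in> A. \<delta> \<le> f j}"
  obtain k :: nat where k: "infsum f A < real k * \<delta>"
    using reals_Archimedean3[OF \<delta>] by blast
  obtain F where F: "F \<subseteq> {j \<in> A. \<delta> \<le> f j}" "finite F" "card F = k"
    using infinite_arbitrarily_large[OF inf] by blast
  have "real k * \<delta> = (\<Sum>j\<in>F. \<delta>)" using F by simp
  also have "\<dots> \<le> sum f F" using F by (intro sum_mono) auto
  also have "\<dots> \<le> infsum f A" using F nonneg f by (intro finite_sum_le_infsum) auto
  finally show False using k by simp
qed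

lemma gaussian_tail_pos: "0 < gaussian_tail \<beta> \<epsilon>"
proof -
  let ?c = "\<epsilon> * \<beta>"
  interpret prob_space "density lborel std_normal_density"
    by (rule prob_space_normal_density) simp
  have "emeasure (density lborel std_normal_density) {?c..} \<noteq> 0"
  proof
    assume "emeasure (density lborel std_normal_density) {?c..} = 0"
    hence "{?c..} \<in> null_sets (density lborel std_normal_density)" by auto
    hence "AE x in lborel. x \<in> {?c..} \<longrightarrow> ennreal (std_normal_density x) = 0"
      by (subst (asm) null_sets_density_iff) auto
    hence "AE x in lborel. x \<notin> {?c..}"
      by (rule eventually_mono)
        (metis ennreal_eq_0_iff normal_density_pos not_le zero_less_one)
    hence "{?c..} \<in> null_sets lborel"
      by (intro AE_iff_null_sets[THEN iffD2]) auto
    \<comment> \<open>a bounded interval, so that its length is a real number\<close>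
    hence "{?c..?c+1} \<in> null_sets lborel"
      by (rule null_sets_subset) auto
    thus False by (simp add: null_sets_def)
  qed
  hence "0 < measure (density lborel std_normal_density) {?c..}"
    by (simp add: emeasure_eq_measure zero_less_measure_iff)
  thus ?thesis by (simp add: gaussian_tail_eq_measure[symmetric])
qed

lemma gaussian_tail_antimono:
  assumes "0 \<le> \<epsilon>" "\<beta> \<le> \<gamma>"
  shows "gaussian_tail \<gamma> \<epsilon> \<le> gaussian_tail \<beta> \<epsilon>"
proof -
  interpret prob_space "density lborel std_normal_density"
    by (rule prob_space_normal_density) simp
  have "\<epsilon> * \<beta> \<le> \<epsilon> * \<gamma>" using assms by (simp add: mult_left_mono)
  hence "measure (density lborel std_normal_density) {\<epsilon> * \<gamma>..} \<le>
      measure (density lborel std_normal_density) {\<epsilon> * \<beta>..}"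
    by (intro finite_measure_mono) auto
  thus ?thesis by (simp add: gaussian_tail_eq_measure[symmetric])
qed

text \<open>The tails \<open>gaussian_tail (b j) 1\<close> decrease in \<open>b j\<close> and are positive, so their summability
  forces the weights to tend to infinity.\<close>

lemma finite_weights_le:
  assumes "(\<lambda>j. gaussian_tail (b j) 1) summable_on E"
  shows "finite {j \<in> E. b j \<le> M}"
proof (rule finite_subset)
  show "{j \<in> E. b j \<le> M} \<subseteq> {j \<in> E. gaussian_tail M 1 \<le> gaussian_tail (b j) 1}"
    by (auto intro: gaussian_tail_antimono)
  show "finite {j \<in> E. gaussian_tail M 1 \<le> gaussian_tail (b j) 1}"
    by (rule finite_superlevel_set_of_summable[OF assms gaussian_tail_nonneg gaussian_tail_pos])
qed

lemma weights_bounded_below: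
  fixes b :: "'a \<Rightarrow> real"
  assumes b: "\<And>j. j \<in> E \<Longrightarrow> 0 < b j"
    and s: "(\<lambda>j. gaussian_tail (b j) 1) summable_on E"
  obtains m where "0 < m" "\<And>j. j \<in> E \<Longrightarrow> m \<le> b j"
proof
  let ?F = "{j \<in> E. b j \<le> 1}"
  let ?m = "Min (insert 1 (b ` ?F))"
  have fin: "finite (insert 1 (b ` ?F))" using finite_weights_le[OF s] by simp
  show "0 < ?m" using fin b by (subst Min_gr_iff) auto
  show "?m \<le> b j" if "j \<in> E" for j
  proof (cases "b j \<le> 1")
    case True
    thus ?thesis using that fin by (intro Min_le) auto
  next
    case False
    have "?m \<le> 1" using fin by (intro Min_le) auto
    with False show ?thesis by simp
  qed
qed

section \<open>Square-summable families and the norm of B(E)\<close>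

lift_definition ell2_unit :: "'a \<Rightarrow> 'a ell2" is "\<lambda>j k. if k = j then 1 else 0"
proof -
  fix j :: 'a
  have "(\<lambda>k. (if k = j then 1 else 0 :: real)\<^sup>2) summable_on {j}" by simp
  thus "(\<lambda>k. (if k = j then 1 else 0 :: real)\<^sup>2) summable_on UNIV"
    by (rule summable_on_cong_neutral[THEN iffD1, rotated -1]) auto
qed

lemma ell2_nth_unit: "ell2_nth (ell2_unit j) k = (if k = j then 1 else 0)"
  by transfer simp

lemma ell2_nth_zero [simp]: "ell2_nth 0 j = 0"
  by transfer simp

lemma ell2_nth_add [simp]: "ell2_nth (x + y) j = ell2_nth x j + ell2_nth y j"
  by transfer simp

lemma ell2_nth_diff [simp]: "ell2_nth (x - y) j = ell2_nth x j - ell2_nth y j"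
  by transfer simp

lemma ell2_nth_scaleR [simp]: "ell2_nth (c *\<^sub>R x) j = c * ell2_nth x j"
  by transfer simp

lemma ell2_nth_sum: "ell2_nth (\<Sum>i\<in>A. f i) j = (\<Sum>i\<in>A. ell2_nth (f i) j)"
  by (induction A rule: infinite_finite_induct) auto

lemma inner_ell2_unit: "inner (ell2_unit j) x = ell2_nth x j"
proof transfer
  fix j :: 'a and x :: "'a \<Rightarrow> real"
  have "(\<Sum>\<^sub>\<infinity>k. (if k = j then 1 else 0) * x k) = (\<Sum>\<^sub>\<infinity>k\<in>{j}. x k)"
    by (rule infsum_cong_neutral) auto
  thus "(\<Sum>\<^sub>\<infinity>k. (if k = j then 1 else 0) * x k) = x j" by simp
qed

lemma inner_ell2_unit_self: "inner (ell2_unit j) (ell2_unit j) = 1"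
  by (simp add: inner_ell2_unit ell2_nth_unit)

lemma abs_ell2_nth_le_norm: "\<bar>ell2_nth x j\<bar> \<le> norm x"
proof -
  have "norm (ell2_unit j) = 1" by (simp add: norm_eq_sqrt_inner inner_ell2_unit_self)
  thus ?thesis using Cauchy_Schwarz_ineq2[of "ell2_unit j" x] by (simp add: inner_ell2_unit)
qed

lemma subspace_ell2_on: "subspace (ell2_on E)"
  by (auto simp: subspace_def ell2_on_def)

lemma ell2_unit_in_ell2_on: "j \<in> E \<Longrightarrow> ell2_unit j \<in> ell2_on E"
  by (auto simp: ell2_on_def ell2_nth_unit)

lemma finite_ell2_nth_ge:
  assumes "0 < \<delta>"
  shows "finite {j. \<delta> \<le> \<bar>ell2_nth x j\<bar>}"
proof (rule finite_subset)
  show "{j. \<delta> \<le> \<bar>ell2_nth x j\<bar>} \<subseteq> {j \<in> UNIV. \<delta>\<^sup>2 \<le> (ell2_nth x j)\<^sup>2}"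
    using assms by (auto simp: abs_le_square_iff[symmetric])
  show "finite {j \<in> UNIV. \<delta>\<^sup>2 \<le> (ell2_nth x j)\<^sup>2}"
    using ell2_nth[of x] assms by (intro finite_superlevel_set_of_summable) auto
qed

lemma B_space_iff:
  assumes "\<And>j. j \<in> E \<Longrightarrow> 0 < b j"
  shows "x \<in> B_space b E \<longleftrightarrow>
    (\<forall>j. j \<notin> E \<longrightarrow> x j = 0) \<and> (\<forall>\<delta>>0. finite {j \<in> E. \<delta> \<le> \<bar>x j\<bar> / b j})"
proof -
  have *: "{j. j \<in> E \<and> \<not> dist (\<bar>x j\<bar> / b j) 0 < \<delta>} = {j \<in> E. \<delta> \<le> \<bar>x j\<bar> / b j}" for \<delta>
  proof -
    have "dist (\<bar>x j\<bar> / b j) 0 = \<bar>x j\<bar> / b j" if "j \<in> E" for j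
      using assms[OF that] by simp
    thus ?thesis by (intro Collect_cong) (metis linorder_not_less)
  qed
  show ?thesis
    unfolding B_space_def tendsto_iff eventually_inf_principal eventually_cofinite not_imp
      mem_Collect_eq * ..
qed

lemma ell2_nth_in_B_space:
  assumes m: "0 < m" "\<And>j. j \<in> E \<Longrightarrow> m \<le> b j" and x: "x \<in> ell2_on E"
  shows "ell2_nth x \<in> B_space b E"
proof -
  have b: "0 < b j" if "j \<in> E" for j using m(1) m(2)[OF that] by simp
  have "finite {j \<in> E. \<delta> \<le> \<bar>ell2_nth x j\<bar> / b j}" if \<delta>: "0 < \<delta>" for \<delta>
  proof (rule finite_subset[OF _ finite_ell2_nth_ge])
    show "0 < \<delta> * m" using \<delta> m by simp
    show "{j \<in> E. \<delta> \<le> \<bar>ell2_nth x j\<bar> / b j} \<subseteq> {j. \<delta> * m \<le> \<bar>ell2_nth x j\<bar>}"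
    proof safe
      fix j assume j: "j \<in> E" and le: "\<delta> \<le> \<bar>ell2_nth x j\<bar> / b j"
      have "\<delta> * m \<le> \<delta> * b j" using \<delta> m(2)[OF j] by (intro mult_left_mono) auto
      also have "\<dots> \<le> \<bar>ell2_nth x j\<bar>" using le b[OF j] by (simp add: pos_le_divide_eq)
      finally show "\<delta> * m \<le> \<bar>ell2_nth x j\<bar>" .
    qed
  qed
  thus ?thesis using x b by (subst B_space_iff) (auto simp: ell2_on_def)
qed

lemma B_norm_le:
  assumes "0 \<le> C" "\<And>j. j \<in> E \<Longrightarrow> \<bar>x j\<bar> / b j \<le> C"
  shows "B_norm b E x \<le> C"
  using assms by (auto simp: B_norm_def intro: cSUP_least)

lemma less_B_norm_iff:
  assumes b: "\<And>j. j \<in> E \<Longrightarrow> 0 < b j" and x: "x \<in> B_space b E" and \<epsilon>: "0 \<le> \<epsilon>"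
  shows "\<epsilon> < B_norm b E x \<longleftrightarrow> (\<exists>j\<in>E. \<epsilon> * b j < \<bar>x j\<bar>)"
proof
  assume "\<epsilon> < B_norm b E x"
  hence "\<not> (\<forall>j\<in>E. \<bar>x j\<bar> / b j \<le> \<epsilon>)" using B_norm_le[of \<epsilon> E x b] \<epsilon> by auto
  then obtain j where "j \<in> E" "\<epsilon> < \<bar>x j\<bar> / b j" by auto
  thus "\<exists>j\<in>E. \<epsilon> * b j < \<bar>x j\<bar>" using b by (auto simp: pos_less_divide_eq)
next
  assume "\<exists>j\<in>E. \<epsilon> * b j < \<bar>x j\<bar>"
  then obtain j where j: "j \<in> E" "\<epsilon> < \<bar>x j\<bar> / b j" using b by (auto simp: pos_less_divide_eq)
  thus "\<epsilon> < B_norm b E x" using B_norm_upper[OF x j(1)] by simp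
qed

text \<open>If \<open>m \<le> b j\<close>, then the inclusion is bounded with constant \<open>1 / m\<close>. For density, an element of
  \<open>B(E)\<close> is approximated by its restriction to the finite set of indices where \<open>\<bar>x j\<bar> / b j\<close> is
  not small.\<close>

lemma densely_embedded_if_bounded_below:
  assumes m: "0 < m" "\<And>j. j \<in> E \<Longrightarrow> m \<le> b j"
  shows "densely_embedded b E"
proof -
  have b: "0 < b j" if "j \<in> E" for j using m(1) m(2)[OF that] by simp
  interpret B: Metric_space "B_space b E" "B_dist b E"
    by (rule Metric_space_B[OF b])
  have emb: "ell2_nth x \<in> B_space b E" if "x \<in> ell2_on E" for x
    using that m by (intro ell2_nth_in_B_space[of m])
  have "continuous_map (top_of_set (ell2_on E)) B.mtopology ell2_nth"
    unfolding B.continuous_map_to_metric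
  proof (intro ballI allI impI)
    fix x \<epsilon> assume "x \<in> topspace (top_of_set (ell2_on E))" and \<epsilon>: "0 < (\<epsilon> :: real)"
    hence x: "x \<in> ell2_on E" by simp
    have "ell2_nth y \<in> B.mball (ell2_nth x) \<epsilon>" if y: "y \<in> ell2_on E \<inter> ball x (\<epsilon> * m)" for y
    proof -
      have "B_norm b E (ell2_nth (x - y)) \<le> norm (x - y) / m"
      proof (rule B_norm_le)
        fix j assume j: "j \<in> E"
        show "\<bar>ell2_nth (x - y) j\<bar> / b j \<le> norm (x - y) / m"
          using abs_ell2_nth_le_norm[of "x - y" j] j m by (intro frac_le) auto
      qed (use m in simp)
      also have "\<dots> < \<epsilon>" using y m by (simp add: dist_norm pos_divide_less_eq)
      finally have "B_norm b E (ell2_nth (x - y)) < \<epsilon>" .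
      moreover have "ell2_nth (x - y) = (\<lambda>j. ell2_nth x j - ell2_nth y j)"
        by (rule ext) simp
      ultimately have "B_norm b E (\<lambda>j. ell2_nth x j - ell2_nth y j) < \<epsilon>" by simp
      thus ?thesis using emb x y by (auto simp: B.in_mball B_dist_def)
    qed
    moreover have "openin (top_of_set (ell2_on E)) (ell2_on E \<inter> ball x (\<epsilon> * m))"
      by (intro openin_open_Int open_ball)
    ultimately show "\<exists>U. openin (top_of_set (ell2_on E)) U \<and> x \<in> U \<and>
        (\<forall>y\<in>U. ell2_nth y \<in> B.mball (ell2_nth x) \<epsilon>)"
      using x \<epsilon> m by (intro exI[of _ "ell2_on E \<inter> ball x (\<epsilon> * m)"]) auto
  qed
  moreover have "B.mtopology closure_of (ell2_nth ` ell2_on E) = B_space b E"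
  proof -
    have "\<exists>y\<in>ell2_nth ` ell2_on E. y \<in> B.mball x r"
      if x: "x \<in> B_space b E" and r: "0 < r" for x r
    proof -
      let ?F = "{j \<in> E. r / 2 \<le> \<bar>x j\<bar> / b j}"
      define y where "y = (\<Sum>j\<in>?F. x j *\<^sub>R ell2_unit j)"
      have fin: "finite ?F"
        using x half_gt_zero[OF r] B_space_iff[of E b x, OF b] by blast
      have y: "y \<in> ell2_on E" unfolding y_def
        by (intro subspace_sum subspace_scale subspace_ell2_on ell2_unit_in_ell2_on) auto
      have nth: "ell2_nth y j = (if j \<in> ?F then x j else 0)" for j
      proof -
        have "ell2_nth y j = (\<Sum>k\<in>?F. if j = k then x k else 0)"
          unfolding y_def ell2_nth_sum ell2_nth_scaleR ell2_nth_unit by (intro sum.cong) auto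
        thus ?thesis by (simp only: sum.delta'[OF fin])
      qed
      have "B_norm b E (\<lambda>j. x j - ell2_nth y j) \<le> r / 2"
        using r by (intro B_norm_le) (auto simp: nth)
      hence "ell2_nth y \<in> B.mball x r"
        using x emb[OF y] r by (simp add: B.in_mball B_dist_def)
      with y show ?thesis by blast
    qed
    thus ?thesis by (auto simp: B.metric_closure_of)
  qed
  ultimately show ?thesis
    using emb by (auto simp: densely_embedded_def B_topology_def)
qed

lemma seminorm_on_B_norm:
  assumes b: "\<And>j. j \<in> E \<Longrightarrow> 0 < b j" and emb: "\<And>x. x \<in> Z \<Longrightarrow> ell2_nth x \<in> B_space b E"
    and Z: "subspace Z"
  shows "seminorm_on Z (\<lambda>x. B_norm b E (ell2_nth x))"
proof -
  have nn: "0 \<le> B_norm b E (ell2_nth x)" if "x \<in> Z" for x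
    by (rule B_norm_nonneg[OF b emb[OF that]])
  have le: "B_norm b E (ell2_nth (c *\<^sub>R x)) \<le> \<bar>c\<bar> * B_norm b E (ell2_nth x)" if x: "x \<in> Z" for c x
  proof (rule B_norm_le)
    fix j assume j: "j \<in> E"
    have "\<bar>c\<bar> * (\<bar>ell2_nth x j\<bar> / b j) \<le> \<bar>c\<bar> * B_norm b E (ell2_nth x)"
      by (intro mult_left_mono B_norm_upper emb x j) simp
    thus "\<bar>ell2_nth (c *\<^sub>R x) j\<bar> / b j \<le> \<bar>c\<bar> * B_norm b E (ell2_nth x)"
      by (simp add: abs_mult)
  qed (simp add: nn x)
  have "B_norm b E (ell2_nth (c *\<^sub>R x)) = \<bar>c\<bar> * B_norm b E (ell2_nth x)" if x: "x \<in> Z" for c x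
  proof (cases "c = 0")
    case True
    thus ?thesis using le[OF x, of c] nn[of "c *\<^sub>R x"] subspace_scale[OF Z x, of c] by simp
  next
    case False
    \<comment> \<open>equality follows by scaling back with \<open>inverse c\<close>\<close>
    have "B_norm b E (ell2_nth (inverse c *\<^sub>R c *\<^sub>R x)) \<le>
        \<bar>inverse c\<bar> * B_norm b E (ell2_nth (c *\<^sub>R x))"
      by (intro le subspace_scale[OF Z x])
    with False have "\<bar>c\<bar> * B_norm b E (ell2_nth x) \<le> B_norm b E (ell2_nth (c *\<^sub>R x))"
      by (simp add: abs_inverse field_simps)
    with le[OF x, of c] show ?thesis by simp
  qed
  moreover have "B_norm b E (ell2_nth (x + y)) \<le> B_norm b E (ell2_nth x) + B_norm b E (ell2_nth y)"
    if x: "x \<in> Z" and y: "y \<in> Z" for x y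
  proof (rule B_norm_le)
    fix j assume j: "j \<in> E"
    have "\<bar>ell2_nth (x + y) j\<bar> / b j \<le> (\<bar>ell2_nth x j\<bar> + \<bar>ell2_nth y j\<bar>) / b j"
      using b[OF j] by (intro divide_right_mono) auto
    also have "\<dots> \<le> B_norm b E (ell2_nth x) + B_norm b E (ell2_nth y)"
      unfolding add_divide_distrib by (intro add_mono B_norm_upper emb x y j)
    finally show "\<bar>ell2_nth (x + y) j\<bar> / b j \<le> B_norm b E (ell2_nth x) + B_norm b E (ell2_nth y)" .
  qed (simp add: nn x y)
  ultimately show ?thesis using nn by (simp add: seminorm_on_def)
qed

section \<open>Orthonormal families and orthogonal projections\<close>

definition orthonormal :: "nat \<Rightarrow> (nat \<Rightarrow> 'z::real_inner) \<Rightarrow> bool" where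
  "orthonormal n f \<longleftrightarrow> (\<forall>i<n. \<forall>k<n. inner (f i) (f k) = (if i = k then 1 else 0))"

lemma inner_orthonormal_sum:
  assumes "orthonormal n f" "k < n"
  shows "inner (f k) (\<Sum>i<n. c i *\<^sub>R f i) = c k"
proof -
  have "inner (f k) (\<Sum>i<n. c i *\<^sub>R f i) = (\<Sum>i<n. if i = k then c i else 0)"
    unfolding inner_sum_right using assms by (intro sum.cong) (auto simp: orthonormal_def)
  thus ?thesis using assms(2) by simp
qed

lemma inner_self_orthonormal_sum:
  assumes "orthonormal n f"
  shows "inner (\<Sum>i<n. c i *\<^sub>R f i) (\<Sum>i<n. c i *\<^sub>R f i) = (\<Sum>i<n. (c i)\<^sup>2)"
proof -
  have "inner (\<Sum>i<n. c i *\<^sub>R f i) (\<Sum>i<n. c i *\<^sub>R f i) =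
      (\<Sum>k<n. c k * inner (f k) (\<Sum>i<n. c i *\<^sub>R f i))"
    by (subst inner_sum_left) simp
  also have "\<dots> = (\<Sum>k<n. (c k)\<^sup>2)"
    using inner_orthonormal_sum[OF assms] by (intro sum.cong) (auto simp: power2_eq_square)
  finally show ?thesis .
qed

lemma Bessel_inequality:
  assumes f: "orthonormal n f"
  shows "(\<Sum>i<n. (inner (f i) x)\<^sup>2) \<le> inner x x"
proof -
  let ?p = "\<Sum>i<n. inner (f i) x *\<^sub>R f i"
  have px: "inner ?p x = (\<Sum>i<n. (inner (f i) x)\<^sup>2)"
    by (simp add: inner_sum_left power2_eq_square)
  have "0 \<le> inner (x - ?p) (x - ?p)" by simp
  also have "\<dots> = inner x x - 2 * inner ?p x + inner ?p ?p"
    by (simp only: inner_diff_left inner_diff_right inner_commute[of x ?p])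
  finally show ?thesis by (simp only: px inner_self_orthonormal_sum[OF f])
qed

lemma orthonormal_basis_of_span:
  fixes B :: "'z::real_inner set"
  assumes "finite B"
  obtains n f where "orthonormal n f" "span (f ` {..<n}) = span B"
proof -
  obtain C where C: "finite C" "span C = span B" "pairwise orthogonal C"
    using basis_orthogonal[OF assms] by blast
  define D where "D = C - {0}"
  have D: "finite D" "0 \<notin> D" "pairwise orthogonal D" "span D = span B"
    using C by (auto simp: D_def pairwise_def span_delete_0)
  obtain h where h: "bij_betw h {0..<card D} D"
    using ex_bij_betw_nat_finite[OF D(1)] by blast
  define f where "f i = h i /\<^sub>R norm (h i)" for i
  have hD: "h i \<in> D" if "i < card D" for i using h that by (auto simp: bij_betw_def)
  have "orthonormal (card D) f"
    unfolding orthonormal_def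
  proof (intro allI impI)
    fix i k assume ik: "i < card D" "k < card D"
    show "inner (f i) (f k) = (if i = k then 1 else 0)"
    proof (cases "i = k")
      case True
      have "h i \<noteq> 0" using hD[OF ik(1)] D(2) by auto
      hence "norm (h i) \<noteq> 0" by simp
      thus ?thesis using True
        by (simp add: f_def dot_square_norm power2_eq_square)
    next
      case False
      hence "h i \<noteq> h k" using h ik by (auto simp: bij_betw_def inj_on_def)
      with D(3) hD[OF ik(1)] hD[OF ik(2)] have "orthogonal (h i) (h k)" by (auto simp: pairwise_def)
      thus ?thesis using False by (simp add: f_def orthogonal_def)
    qed
  qed
  moreover have "span (f ` {..<card D}) = span B"
  proof
    have "f i \<in> span B" if "i < card D" for i
      using span_scale[OF span_base[OF hD[OF that]]] by (simp add: f_def D(4))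
    thus "span (f ` {..<card D}) \<subseteq> span B" by (intro span_minimal) auto
    have "D \<subseteq> span (f ` {..<card D})"
    proof
      fix d assume d: "d \<in> D"
      then obtain i where i: "i < card D" "d = h i"
        using bij_betw_imp_surj_on[OF h] by (metis imageE atLeastLessThan_iff)
      have "h i \<noteq> 0" using hD[OF i(1)] D(2) by auto
      hence "d = norm (h i) *\<^sub>R f i" using i by (simp add: f_def)
      moreover have "f i \<in> span (f ` {..<card D})" using i by (intro span_base) auto
      ultimately show "d \<in> span (f ` {..<card D})" using span_scale by metis
    qed
    thus "span B \<subseteq> span (f ` {..<card D})"
      unfolding D(4)[symmetric] by (intro span_minimal) auto
  qed
  ultimately show ?thesis by (rule that)
qed

lemma orth_proj_span_orthonormal:
  assumes f: "orthonormal n f"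
  shows "orth_proj (span (f ` {..<n})) x = (\<Sum>i<n. inner (f i) x *\<^sub>R f i)"
proof -
  let ?V = "span (f ` {..<n})" and ?p = "\<Sum>i<n. inner (f i) x *\<^sub>R f i"
  have p: "?p \<in> ?V" by (intro span_sum span_scale span_base) auto
  have orth: "orthogonal (x - ?p) w" if "w \<in> ?V" for w
  proof (rule orthogonal_to_span[OF that])
    fix y assume "y \<in> f ` {..<n}"
    then obtain k where k: "k < n" "y = f k" by auto
    have "inner (f k) (x - ?p) = 0"
      unfolding inner_diff_right inner_orthonormal_sum[OF f k(1)] by simp
    thus "orthogonal (x - ?p) y" using k by (simp add: orthogonal_def inner_commute)
  qed
  show ?thesis
    unfolding orth_proj_def
  proof (rule the_equality)
    fix v assume v: "v \<in> ?V \<and> (\<forall>w\<in>?V. orthogonal (x - v) w)"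
    have d: "?p - v \<in> ?V" using p v by (intro span_diff) auto
    have "orthogonal (x - v) (?p - v)" "orthogonal (x - ?p) (?p - v)"
      using v d orth by blast+
    hence "inner ((x - v) - (x - ?p)) (?p - v) = 0"
      by (simp only: orthogonal_def inner_diff_left)
    hence "inner (?p - v) (?p - v) = 0" by simp
    hence "?p - v = 0" by (simp only: inner_eq_zero_iff)
    thus "v = ?p" by simp
  qed (use p orth in blast)
qed

section \<open>Values of the Gaussian cylinder measure\<close>

text \<open>The base of a cylinder set is recovered from the set and the orthonormal family, by testing the
  combination with prescribed coordinates.\<close>

lemma cylinder_rep_set_eq:
  assumes Z: "subspace Z" and rep: "cylinder_rep Z X n f \<Omega>"
  shows "\<Omega> = {y \<in> space (\<Pi>\<^sub>M i\<in>{..<n}. borel). (\<Sum>i<n. y i *\<^sub>R f i) \<in> X}"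
proof -
  have f: "f i \<in> Z" if "i < n" for i using rep that by (simp add: cylinder_rep_def)
  have on: "orthonormal n f" using rep by (simp add: cylinder_rep_def orthonormal_def)
  have sub: "\<Omega> \<subseteq> space (\<Pi>\<^sub>M i\<in>{..<n}. borel)"
    using rep sets.sets_into_space unfolding cylinder_rep_def by blast
  have "(\<Sum>i<n. y i *\<^sub>R f i) \<in> X \<longleftrightarrow> y \<in> \<Omega>" if y: "y \<in> space (\<Pi>\<^sub>M i\<in>{..<n}. borel)" for y
  proof -
    have "(\<Sum>i<n. y i *\<^sub>R f i) \<in> Z"
      using f by (intro subspace_sum[OF Z] subspace_scale[OF Z]) auto
    moreover have "(\<lambda>k\<in>{..<n}. inner (f k) (\<Sum>i<n. y i *\<^sub>R f i)) = (\<lambda>k\<in>{..<n}. y k)"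
      by (rule restrict_ext) (simp add: inner_orthonormal_sum[OF on])
    moreover have "(\<lambda>k\<in>{..<n}. y k) = y"
      using y by (simp add: space_PiM PiE_iff extensional_restrict)
    ultimately show ?thesis using rep by (simp add: cylinder_rep_def)
  qed
  thus ?thesis using sub by auto
qed

text \<open>The representation behind the value of the cylinder measure is chosen arbitrarily, but every
  representation describes \<open>X\<close> in the same way: the value is the probability that the random vector
  \<open>\<Sum>i<n. y i *\<^sub>R f i\<close> lies in \<open>X\<close>. An estimate that is uniform in the orthonormal family \<open>f\<close>
  therefore bounds the measure.\<close>

lemma gaussian_cylinder_measure_eq:
  assumes t: "0 < t" and Z: "subspace Z" and X: "cylinder_set Z X"
  obtains n f where "\<And>i. i < n \<Longrightarrow> f i \<in> Z" "orthonormal n f"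
    "{y \<in> space (gaussian_product t n). (\<Sum>i<n. y i *\<^sub>R f i) \<in> X} \<in> sets (gaussian_product t n)"
    "gaussian_cylinder_measure t Z X =
      measure (gaussian_product t n) {y \<in> space (gaussian_product t n). (\<Sum>i<n. y i *\<^sub>R f i) \<in> X}"
proof -
  obtain n0 f0 \<Omega>0 where "cylinder_rep Z X n0 f0 \<Omega>0"
    using X unfolding cylinder_set_def by blast
  hence "\<exists>m n f \<Omega>. cylinder_rep Z X n f \<Omega> \<and>
      m = (2 * pi * t) powr (- (real n / 2)) *
          (LINT y:\<Omega>|(\<Pi>\<^sub>M i\<in>{..<n}. lborel). exp (- (\<Sum>i<n. (y i)\<^sup>2) / (2 * t)))"
    by blast
  from someI_ex[OF this] obtain n f \<Omega> where rep: "cylinder_rep Z X n f \<Omega>"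
    and eq: "gaussian_cylinder_measure t Z X = (2 * pi * t) powr (- (real n / 2)) *
      (LINT y:\<Omega>|(\<Pi>\<^sub>M i\<in>{..<n}. lborel). exp (- (\<Sum>i<n. (y i)\<^sup>2) / (2 * t)))"
    unfolding gaussian_cylinder_measure_def by blast
  have \<Omega>: "\<Omega> \<in> sets (\<Pi>\<^sub>M i\<in>{..<n}. borel)" using rep by (simp add: cylinder_rep_def)
  have sets: "sets (gaussian_product t n) = sets (\<Pi>\<^sub>M i\<in>{..<n}. borel)"
    by (rule sets_PiM_cong) auto
  have "\<Omega> = {y \<in> space (gaussian_product t n). (\<Sum>i<n. y i *\<^sub>R f i) \<in> X}"
    using cylinder_rep_set_eq[OF Z rep] by (simp add: space_PiM)
  moreover have "gaussian_cylinder_measure t Z X = measure (gaussian_product t n) \<Omega>"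
    unfolding eq by (rule gaussian_integral_eq_measure[OF t \<Omega>])
  ultimately show ?thesis
    using rep \<Omega> sets by (intro that[of n f]) (simp_all add: cylinder_rep_def orthonormal_def)
qed

text \<open>The empty set arises when the subspace is zero. Over a non-zero space a cylinder needs at least
  one unit vector, and over the zero space there is none.\<close>

lemma cylinder_set_empty:
  assumes Z: "subspace Z"
  shows "cylinder_set Z {}"
proof (cases "Z = {0}")
  case True
  have "cylinder_rep Z {} 0 (\<lambda>_. 0) {}" using True by (simp add: cylinder_rep_def)
  thus ?thesis unfolding cylinder_set_def by blast
next
  case False
  then obtain z where z: "z \<in> Z" "z \<noteq> 0" using subspace_0[OF Z] by blast
  have "z /\<^sub>R norm z \<in> Z" by (rule subspace_scale[OF Z z(1)])
  moreover have "inner (z /\<^sub>R norm z) (z /\<^sub>R norm z) = 1"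
    using z(2) by (simp add: dot_square_norm power2_eq_square)
  ultimately have "cylinder_rep Z {} 1 (\<lambda>_. z /\<^sub>R norm z) {}"
    by (simp add: cylinder_rep_def)
  thus ?thesis unfolding cylinder_set_def by blast
qed

text \<open>An orthonormal basis of \<open>V\<close> represents the set, since \<open>orth_proj V x\<close> depends only on the inner
  products of \<open>x\<close> with that basis. If \<open>V\<close> is zero, the basis is empty and so is the set.\<close>

lemma cylinder_set_proj_gt:
  fixes N :: "'z::real_inner \<Rightarrow> real"
  assumes Z: "subspace Z" and V: "finite_dim_subspace Z V"
    and N: "N 0 \<le> \<epsilon>"
    and meas: "\<And>(n::nat) f. (\<And>i. i < n \<Longrightarrow> f i \<in> Z) \<Longrightarrow>
      {y \<in> space (\<Pi>\<^sub>M i\<in>{..<n}. borel). \<epsilon> < N (\<Sum>i<n. y i *\<^sub>R f i)} \<in> sets (\<Pi>\<^sub>M i\<in>{..<n}. borel)"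
  shows "cylinder_set Z {x \<in> Z. \<epsilon> < N (orth_proj V x)}"
proof -
  obtain B where B: "finite B" "V = span B" and VZ: "V \<subseteq> Z"
    using V by (auto simp: finite_dim_subspace_def)
  obtain n f where on: "orthonormal n f" and f: "V = span (f ` {..<n})"
    using orthonormal_basis_of_span[OF B(1)] B(2) by metis
  have proj: "orth_proj V x = (\<Sum>i<n. inner (f i) x *\<^sub>R f i)" for x
    unfolding f by (rule orth_proj_span_orthonormal[OF on])
  show ?thesis
  proof (cases "n = 0")
    case True
    hence empty: "{x \<in> Z. \<epsilon> < N (orth_proj V x)} = {}" using N by (simp add: proj not_less)
    show ?thesis unfolding empty by (rule cylinder_set_empty[OF Z])
  next
    case False
    have fZ: "f i \<in> Z" if "i < n" for i
      using that VZ span_base[of "f i" "f ` {..<n}"] unfolding f by blast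
    let ?\<Omega> = "{y \<in> space (\<Pi>\<^sub>M i\<in>{..<n}. borel). \<epsilon> < N (\<Sum>i<n. y i *\<^sub>R f i)}"
    have "(\<lambda>i\<in>{..<n}. inner (f i) x) \<in> ?\<Omega> \<longleftrightarrow> \<epsilon> < N (orth_proj V x)" for x
      by (simp add: proj space_PiM)
    hence "cylinder_rep Z {x \<in> Z. \<epsilon> < N (orth_proj V x)} n f ?\<Omega>"
      using False fZ on meas[of n f] by (simp add: cylinder_rep_def orthonormal_def)
    thus ?thesis unfolding cylinder_set_def by blast
  qed
qed

text \<open>The vector \<open>p\<close> is the projection of the \<open>j\<close>-th unit vector onto \<open>V\<close>: it has norm at most 1 by
  Bessel's inequality, and it vanishes if the unit vector is orthogonal to \<open>V\<close>.\<close>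

lemma coordinate_of_orth_proj:
  fixes V :: "'a ell2 set"
  assumes "finite B" "V = span B"
  obtains p where "inner p p \<le> 1" "\<And>x. ell2_nth (orth_proj V x) j = inner p x"
    "(\<And>v. v \<in> V \<Longrightarrow> ell2_nth v j = 0) \<Longrightarrow> p = 0"
proof -
  obtain n g where on: "orthonormal n g" and g: "V = span (g ` {..<n})"
    using orthonormal_basis_of_span[OF assms(1)] assms(2) by metis
  \<comment> \<open>the coordinates of the \<open>j\<close>-th unit vector in the basis \<open>g\<close> are the \<open>j\<close>-th coordinates of \<open>g\<close>\<close>
  define p where "p = (\<Sum>k<n. ell2_nth (g k) j *\<^sub>R g k)"
  have "inner p p = (\<Sum>k<n. (inner (g k) (ell2_unit j))\<^sup>2)"
    unfolding p_def inner_self_orthonormal_sum[OF on]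
    by (simp add: inner_commute[of _ "ell2_unit j"] inner_ell2_unit)
  also have "\<dots> \<le> 1"
    using Bessel_inequality[OF on, of "ell2_unit j"] by (simp add: inner_ell2_unit_self)
  finally have "inner p p \<le> 1" .
  moreover have "ell2_nth (orth_proj V x) j = inner p x" for x
    unfolding g orth_proj_span_orthonormal[OF on] p_def
    by (simp add: ell2_nth_sum inner_sum_left mult.commute)
  moreover have "p = 0" if "\<And>v. v \<in> V \<Longrightarrow> ell2_nth v j = 0"
    unfolding p_def using that span_base[of _ "g ` {..<n}"] by (intro sum.neutral) (simp add: g)
  ultimately show ?thesis by (rule that)
qed

section \<open>Measurability of the norm of B(E)\<close>

lemma cylinder_set_B_norm_proj_gt:
  assumes E: "countable E" and b: "\<And>j. j \<in> E \<Longrightarrow> 0 < b j"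
    and emb: "\<And>x. x \<in> ell2_on E \<Longrightarrow> ell2_nth x \<in> B_space b E"
    and \<epsilon>: "0 < \<epsilon>" and V: "finite_dim_subspace (ell2_on E) V"
  shows "cylinder_set (ell2_on E) {x \<in> ell2_on E. \<epsilon> < B_norm b E (ell2_nth (orth_proj V x))}"
proof (rule cylinder_set_proj_gt[OF subspace_ell2_on V])
  show "B_norm b E (ell2_nth 0) \<le> \<epsilon>" using \<epsilon> by (intro B_norm_le) auto
  fix n and f :: "nat \<Rightarrow> 'a ell2" assume f: "\<And>i. i < n \<Longrightarrow> f i \<in> ell2_on E"
  let ?P = "\<Pi>\<^sub>M i\<in>{..<n}. (borel :: real measure)"
  have "\<epsilon> < B_norm b E (ell2_nth (\<Sum>i<n. y i *\<^sub>R f i)) \<longleftrightarrow>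
      (\<exists>j\<in>E. \<epsilon> * b j < \<bar>\<Sum>i<n. y i * ell2_nth (f i) j\<bar>)" for y
  proof -
    have "(\<Sum>i<n. y i *\<^sub>R f i) \<in> ell2_on E"
      using f by (intro subspace_sum subspace_scale subspace_ell2_on) auto
    from less_B_norm_iff[OF b emb[OF this]] \<epsilon> show ?thesis by (simp add: ell2_nth_sum)
  qed
  hence eq: "{y \<in> space ?P. \<epsilon> < B_norm b E (ell2_nth (\<Sum>i<n. y i *\<^sub>R f i))} =
      (\<Union>j\<in>E. {y \<in> space ?P. \<epsilon> * b j < \<bar>\<Sum>i<n. y i * ell2_nth (f i) j\<bar>})"
    by auto
  show "{y \<in> space ?P. \<epsilon> < B_norm b E (ell2_nth (\<Sum>i<n. y i *\<^sub>R f i))} \<in> sets ?P"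
    unfolding eq by (rule sets.countable_UN''[OF E]) measurable
qed

text \<open>The norm of the projection exceeds \<open>\<epsilon>\<close> only if some coordinate \<open>j\<close> of it exceeds \<open>\<epsilon> * b j\<close>. That
  coordinate is the inner product with a vector of norm at most 1, hence a centred Gaussian
  variable of variance at most \<open>t\<close>, and it is identically 0 for \<open>j\<close> in \<open>F\<close>. The union bound over
  the remaining indices gives the sum of tails.\<close>

lemma gaussian_cylinder_measure_B_norm_le:
  assumes t: "0 < t" and E: "countable E" and b: "\<And>j. j \<in> E \<Longrightarrow> 0 < b j"
    and emb: "\<And>x. x \<in> ell2_on E \<Longrightarrow> ell2_nth x \<in> B_space b E"
    and \<epsilon>: "0 < \<epsilon>" and V: "finite_dim_subspace (ell2_on E) V"
    and F: "F \<subseteq> E" "\<And>v j. v \<in> V \<Longrightarrow> j \<in> F \<Longrightarrow> ell2_nth v j = 0"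
    and summable: "(\<lambda>j. gaussian_tail (b j) (\<epsilon> / sqrt t)) summable_on (E - F)"
  shows "gaussian_cylinder_measure t (ell2_on E) {x \<in> ell2_on E. \<epsilon> < B_norm b E (ell2_nth (orth_proj V x))} \<le>
    (\<Sum>\<^sub>\<infinity>j\<in>E - F. gaussian_tail (b j) (\<epsilon> / sqrt t))"
proof -
  let ?Z = "ell2_on E" and ?X = "{x \<in> ell2_on E. \<epsilon> < B_norm b E (ell2_nth (orth_proj V x))}"
  obtain B where B: "finite B" "V = span B" and VZ: "V \<subseteq> ?Z"
    using V by (auto simp: finite_dim_subspace_def)
  have "\<forall>j. \<exists>p. inner p p \<le> 1 \<and> (\<forall>x. ell2_nth (orth_proj V x) j = inner p x) \<and>
      ((\<forall>v\<in>V. ell2_nth v j = 0) \<longrightarrow> p = 0)"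
  proof
    fix j
    show "\<exists>p. inner p p \<le> 1 \<and> (\<forall>x. ell2_nth (orth_proj V x) j = inner p x) \<and>
        ((\<forall>v\<in>V. ell2_nth v j = 0) \<longrightarrow> p = 0)"
      by (rule coordinate_of_orth_proj[OF B, of j]) blast
  qed
  then obtain p where p: "\<And>j. inner (p j) (p j) \<le> 1"
    "\<And>j x. ell2_nth (orth_proj V x) j = inner (p j) x"
    "\<And>j. (\<forall>v\<in>V. ell2_nth v j = 0) \<Longrightarrow> p j = 0"
    by metis
  have p0: "p j = 0" if "j \<in> F" for j using p(3) F(2) that by blast
  have proj: "orth_proj V x \<in> ?Z" for x
  proof -
    obtain n g where g: "orthonormal n g" "V = span (g ` {..<n})"
      using orthonormal_basis_of_span[OF B(1)] B(2) by metis
    have "orth_proj V x \<in> V"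
      unfolding g(2) orth_proj_span_orthonormal[OF g(1)] by (intro span_sum span_scale span_base) auto
    thus ?thesis using VZ by blast
  qed
  obtain n f where f: "\<And>i. i < n \<Longrightarrow> f i \<in> ?Z" and on: "orthonormal n f"
    and eq: "gaussian_cylinder_measure t ?Z ?X =
      measure (gaussian_product t n) {y \<in> space (gaussian_product t n). (\<Sum>i<n. y i *\<^sub>R f i) \<in> ?X}"
    using gaussian_cylinder_measure_eq[OF t subspace_ell2_on cylinder_set_B_norm_proj_gt[OF E b emb \<epsilon> V]]
    by blast
  let ?P = "gaussian_product t n"
  interpret prob_space ?P by (rule prob_space_gaussian_product[OF t])
  define a where "a j i = inner (p j) (f i)" for j i
  define A where "A j = {y \<in> space ?P. \<epsilon> * b j < \<bar>\<Sum>i<n. a j i * y i\<bar>}" for j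
  \<comment> \<open>Bessel's inequality again, now for the family \<open>f\<close> of the chosen representation\<close>
  have a: "(\<Sum>i<n. (a j i)\<^sup>2) \<le> 1" for j
    using Bessel_inequality[OF on, of "p j"] p(1)[of j] by (simp add: a_def inner_commute)
  have "(\<Sum>i<n. y i *\<^sub>R f i) \<in> ?X \<longleftrightarrow> (\<exists>j\<in>E - F. \<epsilon> * b j < \<bar>\<Sum>i<n. a j i * y i\<bar>)" for y
  proof -
    let ?x = "\<Sum>i<n. y i *\<^sub>R f i"
    have nth: "ell2_nth (orth_proj V ?x) j = (\<Sum>i<n. a j i * y i)" for j
      unfolding p(2) by (simp add: a_def inner_sum_right mult.commute)
    have "?x \<in> ?Z"
      using f by (intro subspace_sum subspace_scale subspace_ell2_on) auto
    hence "?x \<in> ?X \<longleftrightarrow> (\<exists>j\<in>E. \<epsilon> * b j < \<bar>\<Sum>i<n. a j i * y i\<bar>)"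
      using less_B_norm_iff[OF b emb[OF proj]] \<epsilon> by (simp add: nth)
    moreover have "\<not> \<epsilon> * b j < \<bar>\<Sum>i<n. a j i * y i\<bar>" if "j \<in> F" for j
      using p0[OF that] F(1) b that \<epsilon> by (auto simp: a_def not_less intro!: mult_nonneg_nonneg less_imp_le)
    ultimately show ?thesis by blast
  qed
  hence "{y \<in> space ?P. (\<Sum>i<n. y i *\<^sub>R f i) \<in> ?X} = (\<Union>j\<in>E - F. A j)"
    by (auto simp: A_def)
  hence "gaussian_cylinder_measure t ?Z ?X = measure ?P (\<Union>j\<in>E - F. A j)"
    by (simp only: eq)
  also have "\<dots> \<le> (\<Sum>\<^sub>\<infinity>j\<in>E - F. gaussian_tail (b j) (\<epsilon> / sqrt t))"
  proof (rule measure_countable_Union_le_infsum[OF _ summable])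
    show "countable (E - F)" using E by simp
    have [measurable]: "(\<lambda>y. y i) \<in> borel_measurable ?P" if "i < n" for i
      by (rule measurable_gaussian_coordinate[OF that])
    show "A j \<in> sets ?P" for j unfolding A_def by measurable
    fix j assume "j \<in> E - F"
    hence "0 < \<epsilon> * b j" using b \<epsilon> by simp
    hence "measure ?P (A j) \<le> gaussian_tail (\<epsilon> * b j) (1 / sqrt t)"
      unfolding A_def by (rule gaussian_linear_functional_tail[OF t a])
    also have "\<dots> = gaussian_tail (b j) (\<epsilon> / sqrt t)"
      by (simp add: gaussian_tail_def)
    finally show "measure ?P (A j) \<le> gaussian_tail (b j) (\<epsilon> / sqrt t)" .
  qed
  finally show ?thesis .
qed

lemma infsum_cofinite_less:
  fixes g :: "'a \<Rightarrow> real"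
  assumes g: "g summable_on E" and \<epsilon>: "0 < \<epsilon>"
  obtains F where "finite F" "F \<subseteq> E" "infsum g (E - F) < \<epsilon>"
proof -
  obtain F where F: "finite F" "F \<subseteq> E" "dist (sum g F) (infsum g E) \<le> \<epsilon> / 2"
    using infsum_finite_approximation[OF g, of "\<epsilon> / 2"] \<epsilon> by auto
  have "infsum g (E - F) = infsum g E - sum g F"
    using infsum_Diff[OF g _ F(2)] F(1) by simp
  moreover have "infsum g E - sum g F \<le> \<epsilon> / 2"
    using F(3) by (simp only: dist_real_def abs_le_iff) linarith
  ultimately show ?thesis using F(1,2) \<epsilon> by (intro that[of F]) auto
qed

text \<open>The exceptional subspace is spanned by the unit vectors of a finite set \<open>F\<close> outside of which the
  tails sum to less than \<open>\<epsilon>\<close>.\<close>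

lemma measurable_seminorm_B_norm:
  assumes t: "0 < t" and E: "countable E" and b: "\<And>j. j \<in> E \<Longrightarrow> 0 < b j"
    and emb: "\<And>x. x \<in> ell2_on E \<Longrightarrow> ell2_nth x \<in> B_space b E"
    and summable: "\<And>\<epsilon>. 0 < \<epsilon> \<Longrightarrow> (\<lambda>j. gaussian_tail (b j) \<epsilon>) summable_on E"
  shows "measurable_seminorm t (ell2_on E) (\<lambda>x. B_norm b E (ell2_nth x))"
  unfolding measurable_seminorm_def
proof (intro conjI allI impI)
  show "seminorm_on (ell2_on E) (\<lambda>x. B_norm b E (ell2_nth x))"
    by (rule seminorm_on_B_norm[OF b emb subspace_ell2_on])
  fix \<epsilon> :: real assume \<epsilon>: "0 < \<epsilon>"
  let ?g = "\<lambda>j. gaussian_tail (b j) (\<epsilon> / sqrt t)"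
  have g: "?g summable_on E" using t \<epsilon> by (intro summable) simp
  obtain F where F: "finite F" "F \<subseteq> E" "infsum ?g (E - F) < \<epsilon>"
    using infsum_cofinite_less[OF g \<epsilon>] by blast
  have "finite_dim_subspace (ell2_on E) (span (ell2_unit ` F))"
    unfolding finite_dim_subspace_def
    using F
    by (intro conjI span_minimal subspace_ell2_on exI[of _ "ell2_unit ` F"])
      (auto intro: ell2_unit_in_ell2_on)
  moreover have "cylinder_set (ell2_on E) {x \<in> ell2_on E. B_norm b E (ell2_nth (orth_proj V x)) > \<epsilon>} \<and>
      gaussian_cylinder_measure t (ell2_on E)
        {x \<in> ell2_on E. B_norm b E (ell2_nth (orth_proj V x)) > \<epsilon>} < \<epsilon>"
    if V: "finite_dim_subspace (ell2_on E) V \<and> (\<forall>v\<in>V. \<forall>h\<in>span (ell2_unit ` F). orthogonal v h)" for V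
  proof
    show "cylinder_set (ell2_on E) {x \<in> ell2_on E. B_norm b E (ell2_nth (orth_proj V x)) > \<epsilon>}"
      by (rule cylinder_set_B_norm_proj_gt[OF E b emb \<epsilon> conjunct1[OF V]])
    have 0: "ell2_nth v j = 0" if "v \<in> V" "j \<in> F" for v j
    proof -
      have "ell2_unit j \<in> span (ell2_unit ` F)" using that by (intro span_base imageI)
      hence "orthogonal v (ell2_unit j)" using V that by blast
      thus ?thesis by (simp add: orthogonal_def inner_commute[of v] inner_ell2_unit)
    qed
    have tail: "?g summable_on (E - F)" by (rule summable_on_cofin_subset[OF g F(1)])
    have "gaussian_cylinder_measure t (ell2_on E)
        {x \<in> ell2_on E. B_norm b E (ell2_nth (orth_proj V x)) > \<epsilon>} \<le> infsum ?g (E - F)"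
      by (rule gaussian_cylinder_measure_B_norm_le[OF t E b emb \<epsilon> conjunct1[OF V] F(2) 0 tail])
    with F(3) show "gaussian_cylinder_measure t (ell2_on E)
        {x \<in> ell2_on E. B_norm b E (ell2_nth (orth_proj V x)) > \<epsilon>} < \<epsilon>"
      by linarith
  qed
  ultimately show "\<exists>H. finite_dim_subspace (ell2_on E) H \<and>
      (\<forall>V. finite_dim_subspace (ell2_on E) V \<and> (\<forall>v\<in>V. \<forall>h\<in>H. orthogonal v h) \<longrightarrow>
         cylinder_set (ell2_on E) {x \<in> ell2_on E. B_norm b E (ell2_nth (orth_proj V x)) > \<epsilon>} \<and>
         gaussian_cylinder_measure t (ell2_on E)
           {x \<in> ell2_on E. B_norm b E (ell2_nth (orth_proj V x)) > \<epsilon>} < \<epsilon>)"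
    by blast
qed

theorem theorem2p3:
  fixes \<Gamma> :: "'a set" and b :: "'a \<Rightarrow> real"
  assumes "countable \<Gamma>"
    and "\<And>j. j \<in> \<Gamma> \<Longrightarrow> 0 < b j"
    and "\<And>\<epsilon>. 0 < \<epsilon> \<Longrightarrow> (\<lambda>j. gaussian_tail (b j) \<epsilon>) summable_on \<Gamma>"
  shows "\<forall>E\<subseteq>\<Gamma>. densely_embedded b E \<and>
           (\<forall>t>0. measurable_seminorm t (ell2_on E) (\<lambda>x. B_norm b E (ell2_nth x)))"
proof (intro allI impI)
  fix E assume "E \<subseteq> \<Gamma>"
  hence E: "countable E" and b: "\<And>j. j \<in> E \<Longrightarrow> 0 < b j"
    and summable: "\<And>\<epsilon>. 0 < \<epsilon> \<Longrightarrow> (\<lambda>j. gaussian_tail (b j) \<epsilon>) summable_on E"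
    using assms countable_subset summable_on_subset_banach by blast+
  obtain m where m: "0 < m" "\<And>j. j \<in> E \<Longrightarrow> m \<le> b j"
    using weights_bounded_below[OF b summable[OF zero_less_one]] by blast
  show "densely_embedded b E \<and>
      (\<forall>t>0. measurable_seminorm t (ell2_on E) (\<lambda>x. B_norm b E (ell2_nth x)))"
  proof (intro conjI allI impI)
    show "densely_embedded b E"
      using m by (rule densely_embedded_if_bounded_below)
    show "measurable_seminorm t (ell2_on E) (\<lambda>x. B_norm b E (ell2_nth x))" if "0 < t" for t
      using m by (intro measurable_seminorm_B_norm that E b summable ell2_nth_in_B_space[of m])
  qed
qed

end
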